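(* Let $X$ be a Banach space with the metric $\pi$-property and whose norm locally depends upon finitely many coordinates (in particular, $X=c_0(I)$), and let $Y$ be a Hilbert space. Then both $\operatorname{NA}_\pi(X\widehat{\otimes}_\pi Y)$ and $(X\widehat{\otimes}_\pi Y)\setminus\operatorname{NA}_\pi(X\widehat{\otimes}_\pi Y)$ are dense in $X\widehat{\otimes}_\pi Y$.
   Context: All Banach and Hilbert spaces are real; $S_X$ is the unit sphere of $X$ and $X^*$ its topological dual. For a set $I$, $c_0(I)$ is the usual Banach space of real families indexed by $I$ vanishing at infinity, with the supremum norm. The projective tensor product $X\widehat{\otimes}_\pi Y$ is the completion of the algebraic tensor product $X\otimes Y$ under the norm $\|z\|_\pi=\inf\{\sum_{i=1}^n\|x_i\|\|y_i\|: z=\sum_{i=1}^n x_i\otimes y_i\}$. Density is with respect to the norm topology. An element $z\in X\widehat{\otimes}_\pi Y$ attains its projective norm if there exist sequences $(x_n)$ in $X$ and $(y_n)$ in $Y$ such that $\|z\|_\pi=\sum_{n=1}^\infty\|x_n\|\|y_n\|$ and $z=\sum_{n=1}^\infty x_n\otimes y_n$ (norm convergence in $X\widehat{\otimes}_\pi Y$). $\operatorname{NA}_\pi(X\widehat{\otimes}_\pi Y)$ denotes the set of all such $z$. The norm of a Banach space $X$ locally depends upon finitely many coordinates if for every $x\in X\setminus\{0\}$ there exist $\varepsilon>0$, a finite subset $\{f_1,\ldots,f_N\}\subseteq X^*$ and a continuous function $\varphi:\mathbb{R}^N\longrightarrow\mathbb{R}$ such that $\|y\|=\varphi(f_1(y),\ldots,f_N(y))$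 for every $y\in X$ with $\|y-x\|<\varepsilon$. A Banach space $X$ has the metric $\pi$-property if given $\varepsilon>0$ and a finite collection $\{x_1,\ldots,x_n\}\subseteq S_X$, there is a finite dimensional $1$-complemented subspace $M\subseteq X$ (i.e. $M$ is the range of a linear projection on $X$ of norm at most one) such that for each $i\in\{1,\ldots,n\}$ there exists $x_i'\in M$ with $\|x_i-x_i'\|<\varepsilon$.
   Formalization: Density of the complement of NA is asserted only when X and Y are both infinite-dimensional (for c_0(I): I infinite); without this it fails, e.g. for X = c_0 and Y = ℝ, where every element attains its projective norm. *)

theory Defs
  imports "HOL-Analysis.Analysis"
begin

section \<open>Norming functionals\<close>

text \<open>The real Hahn--Banach theorem, needed below to see that the projective seminorm is a norm.
  A minimal sublinear functional is linear, and minimal ones exist by Zorn's lemma.\<close>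

definition sublin :: "('a::real_vector \<Rightarrow> real) \<Rightarrow> bool" where
  "sublin q \<longleftrightarrow> (\<forall>x y. q (x + y) \<le> q x + q y) \<and> (\<forall>c x. 0 \<le> c \<longrightarrow> q (c *\<^sub>R x) = c * q x)"

definition shrink :: "('a::real_vector \<Rightarrow> real) \<Rightarrow> 'a \<Rightarrow> 'a \<Rightarrow> real" where
  "shrink q w v = (INF t\<in>{0..}. q (v + t *\<^sub>R w) - t * q w)"

lemma sublin_zero: "sublin q \<Longrightarrow> q 0 = 0"
  unfolding sublin_def by (metis mult_zero_left order_refl scaleR_zero_left)

lemma sublin_lower: "sublin q \<Longrightarrow> - q (- v) \<le> q v"
proof -
  assume q: "sublin q"
  have "q (v + - v) \<le> q v + q (- v)" using q unfolding sublin_def by blast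
  then show ?thesis using sublin_zero[OF q] by simp
qed

lemma shrink_bdd:
  assumes q: "sublin q"
  shows "bdd_below ((\<lambda>t. q (v + t *\<^sub>R w) - t * q w) ` {0..})"
proof (rule bdd_belowI2[where m = "- q (- v)"])
  fix t :: real assume t: "t \<in> {0..}"
  have "q (t *\<^sub>R w) \<le> q (v + t *\<^sub>R w) + q (- v)"
    using q unfolding sublin_def by (metis add.commute add_minus_cancel)
  moreover have "q (t *\<^sub>R w) = t * q w" using q t unfolding sublin_def by simp
  ultimately show "- q (- v) \<le> q (v + t *\<^sub>R w) - t * q w" by simp
qed

lemma shrink_le:
  assumes q: "sublin q" and t: "0 \<le> t"
  shows "shrink q w v \<le> q (v + t *\<^sub>R w) - t * q w"
  unfolding shrink_def by (rule cINF_lower[OF shrink_bdd[OF q]]) (use t in auto)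

lemma shrink_greatest:
  assumes "\<And>t. 0 \<le> t \<Longrightarrow> m \<le> q (v + t *\<^sub>R w) - t * q w"
  shows "m \<le> shrink q w v"
  unfolding shrink_def by (rule cINF_greatest) (use assms in auto)

lemma shrink_le_self: "sublin q \<Longrightarrow> shrink q w v \<le> q v"
  using shrink_le[of q 0 w v] by simp

lemma shrink_sublin:
  assumes q: "sublin q"
  shows "sublin (shrink q w)"
proof -
  have qa: "q (x + y) \<le> q x + q y" for x y using q unfolding sublin_def by blast
  have qs: "q (c *\<^sub>R x) = c * q x" if "0 \<le> c" for c x using q that unfolding sublin_def by blast
  have add: "shrink q w (x + y) \<le> shrink q w x + shrink q w y" for x y
  proof -
    have *: "shrink q w (x + y) \<le> (q (x + s *\<^sub>R w) - s * q w) + (q (y + t *\<^sub>R w) - t * q w)"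
      if "0 \<le> s" "0 \<le> t" for s t
    proof -
      have "shrink q w (x + y) \<le> q ((x + y) + (s + t) *\<^sub>R w) - (s + t) * q w"
        by (rule shrink_le[OF q]) (use that in auto)
      moreover have "(x + y) + (s + t) *\<^sub>R w = (x + s *\<^sub>R w) + (y + t *\<^sub>R w)"
        by (simp add: algebra_simps)
      ultimately show ?thesis using qa[of "x + s *\<^sub>R w" "y + t *\<^sub>R w"]
        by (simp add: algebra_simps)
    qed
    have "shrink q w (x + y) - (q (x + s *\<^sub>R w) - s * q w) \<le> shrink q w y" if "0 \<le> s" for s
      by (rule shrink_greatest) (use *[OF that] in \<open>simp add: algebra_simps\<close>)
    then have "shrink q w (x + y) - shrink q w y \<le> q (x + s *\<^sub>R w) - s * q w" if "0 \<le> s" for s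
      using that by (smt (verit))
    then have "shrink q w (x + y) - shrink q w y \<le> shrink q w x" by (rule shrink_greatest)
    then show ?thesis by simp
  qed
  have le: "shrink q w (c *\<^sub>R x) \<le> c * shrink q w x" if c: "0 < c" for c x
  proof -
    have "shrink q w (c *\<^sub>R x) / c \<le> q (x + t *\<^sub>R w) - t * q w" if t: "0 \<le> t" for t
    proof -
      have "shrink q w (c *\<^sub>R x) \<le> q (c *\<^sub>R x + (c * t) *\<^sub>R w) - (c * t) * q w"
        by (rule shrink_le[OF q]) (use c t in auto)
      also have "c *\<^sub>R x + (c * t) *\<^sub>R w = c *\<^sub>R (x + t *\<^sub>R w)" by (simp add: scaleR_add_right)
      also have "q \<dots> = c * q (x + t *\<^sub>R w)" using qs c by simp
      finally show ?thesis using c by (simp add: field_simps)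
    qed
    then have "shrink q w (c *\<^sub>R x) / c \<le> shrink q w x" by (rule shrink_greatest)
    then show ?thesis using c by (simp add: field_simps)
  qed
  have scale: "shrink q w (c *\<^sub>R x) = c * shrink q w x" if c: "0 \<le> c" for c x
  proof (cases "c = 0")
    case True
    have "0 \<le> shrink q w 0" by (rule shrink_greatest) (simp add: qs)
    moreover have "shrink q w 0 \<le> q 0" by (rule shrink_le_self[OF q])
    ultimately show ?thesis using True sublin_zero[OF q] by simp
  next
    case False
    then have c: "0 < c" using c by simp
    have "shrink q w (inverse c *\<^sub>R (c *\<^sub>R x)) \<le> inverse c * shrink q w (c *\<^sub>R x)"
      by (rule le) (use c in simp)
    then have "c * shrink q w x \<le> shrink q w (c *\<^sub>R x)" using c by (simp add: field_simps)
    then show ?thesis using le[OF c, of x] by simp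
  qed
  show ?thesis unfolding sublin_def using add scale by blast
qed

lemma sublin_INF:
  assumes ne: "C \<noteq> {}" and sub: "\<And>q. q \<in> C \<Longrightarrow> sublin q"
    and p: "\<And>q x. q \<in> C \<Longrightarrow> q x \<le> p x"
    and chain: "\<And>q r. q \<in> C \<Longrightarrow> r \<in> C \<Longrightarrow> (\<forall>x. q x \<le> r x) \<or> (\<forall>x. r x \<le> q x)"
  shows "sublin (\<lambda>x. INF q\<in>C. q x) \<and> (\<forall>q\<in>C. \<forall>x. (INF q\<in>C. q x) \<le> q x)"
proof -
  have bdd: "bdd_below ((\<lambda>q. q x) ` C)" for x
    by (rule bdd_belowI2[where m = "- p (- x)"])
      (use sublin_lower[OF sub] p in \<open>smt (verit)\<close>)
  have low: "(INF q\<in>C. q x) \<le> q x" if "q \<in> C" for q x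
    by (rule cINF_lower[OF bdd that])
  have add: "(INF q\<in>C. q (x + y)) \<le> (INF q\<in>C. q x) + (INF q\<in>C. q y)" for x y
  proof -
    have *: "(INF q\<in>C. q (x + y)) \<le> q x + r y" if qr: "q \<in> C" "r \<in> C" for q r
    proof -
      have a: "(INF q\<in>C. q (x + y)) \<le> q x + q y" "(INF q\<in>C. q (x + y)) \<le> r x + r y"
        using low[OF qr(1), of "x + y"] low[OF qr(2), of "x + y"] sub[OF qr(1)] sub[OF qr(2)]
        unfolding sublin_def by (meson order_trans)+
      show ?thesis using chain[OF qr] a by (smt (verit))
    qed
    have "(INF q\<in>C. q (x + y)) - q x \<le> (INF q\<in>C. q y)" if "q \<in> C" for q
      by (rule cINF_greatest[OF ne]) (use *[OF that] in \<open>simp add: algebra_simps\<close>)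
    then have "(INF q\<in>C. q (x + y)) - (INF q\<in>C. q y) \<le> q x" if "q \<in> C" for q
      using that by (smt (verit))
    then have "(INF q\<in>C. q (x + y)) - (INF q\<in>C. q y) \<le> (INF q\<in>C. q x)"
      by (rule cINF_greatest[OF ne])
    then show ?thesis by simp
  qed
  have le: "(INF q\<in>C. q (c *\<^sub>R x)) \<le> c * (INF q\<in>C. q x)" if c: "0 < c" for c x
  proof -
    have "(INF q\<in>C. q (c *\<^sub>R x)) / c \<le> q x" if "q \<in> C" for q
      using low[OF that, of "c *\<^sub>R x"] sub[OF that] c unfolding sublin_def
      by (simp add: field_simps)
    then have "(INF q\<in>C. q (c *\<^sub>R x)) / c \<le> (INF q\<in>C. q x)" by (rule cINF_greatest[OF ne])
    then show ?thesis using c by (simp add: field_simps)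
  qed
  have scale: "(INF q\<in>C. q (c *\<^sub>R x)) = c * (INF q\<in>C. q x)" if c: "0 \<le> c" for c x
  proof (cases "c = 0")
    case True
    have "(INF q\<in>C. q 0) = (INF q\<in>C. (0::real))"
      by (rule INF_cong) (use sublin_zero[OF sub] in auto)
    then show ?thesis using True ne by simp
  next
    case False
    then have c: "0 < c" using c by simp
    have "(INF q\<in>C. q (inverse c *\<^sub>R (c *\<^sub>R x))) \<le> inverse c * (INF q\<in>C. q (c *\<^sub>R x))"
      by (rule le) (use c in simp)
    then have "c * (INF q\<in>C. q x) \<le> (INF q\<in>C. q (c *\<^sub>R x))" using c by (simp add: field_simps)
    then show ?thesis using le[OF c, of x] by simp
  qed
  show ?thesis unfolding sublin_def using add scale low by blast
qed

lemma sublin_dominates_linear: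
  assumes p: "sublin p"
  shows "\<exists>f. linear f \<and> (\<forall>x. f x \<le> p x)"
proof -
  let ?A = "{q. sublin q \<and> (\<forall>x. q x \<le> p x)}"
  let ?P = "\<lambda>q r. \<forall>x. r x \<le> (q x :: real)"
  have po: "partial_order_on ?A (relation_of ?P ?A)"
  proof (rule partial_order_on_relation_ofI)
    show "?P a a" for a by simp
    show "?P a c" if "?P a b" "?P b c" for a b c using that by (meson order_trans)
    show "a = b" if "?P a b" "?P b a" for a b using that by (intro ext) (meson order_antisym)
  qed
  have ub: "\<exists>u\<in>?A. \<forall>a\<in>C. ?P a u" if C: "C \<in> Chains (relation_of ?P ?A)" for C
  proof (cases "C = {}")
    case True then show ?thesis using p by auto
  next
    case False
    have CA: "C \<subseteq> ?A" and ch: "\<And>q r. q \<in> C \<Longrightarrow> r \<in> C \<Longrightarrow> (\<forall>x. q x \<le> r x) \<or> (\<forall>x. r x \<le> q x)"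
      using C unfolding Chains_def relation_of_def by blast+
    have I: "sublin (\<lambda>x. INF q\<in>C. q x) \<and> (\<forall>q\<in>C. \<forall>x. (INF q\<in>C. q x) \<le> q x)"
      by (rule sublin_INF[of C p]) (use False CA ch in auto)
    moreover have "(INF q\<in>C. q x) \<le> p x" for x
    proof -
      obtain q where q: "q \<in> C" using False by blast
      then have "(INF q\<in>C. q x) \<le> q x" "q x \<le> p x" using I CA by blast+
      then show ?thesis by (rule order_trans)
    qed
    ultimately show ?thesis by (intro bexI[of _ "\<lambda>x. INF q\<in>C. q x"]) auto
  qed
  obtain q where q: "q \<in> ?A" and min: "\<And>r. r \<in> ?A \<Longrightarrow> ?P q r \<Longrightarrow> r = q"
    using predicate_Zorn[OF po ub] by blast
  have sq: "sublin q" using q by simp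
  have shr: "shrink q w = q" for w
  proof (rule min)
    have "shrink q w x \<le> p x" for x
      using shrink_le_self[OF sq, of w x] q by (auto intro: order_trans)
    then show "shrink q w \<in> ?A" using shrink_sublin[OF sq] by simp
  qed (use shrink_le_self[OF sq] in blast)
  have super: "q v + q w \<le> q (v + w)" for v w
    using shrink_le[OF sq, of 1 w v] shr[of w] by simp
  have add: "q (v + w) = q v + q w" for v w
    using super[of v w] sq unfolding sublin_def by (meson order_antisym)
  have neg: "q (- v) = - q v" for v using add[of v "- v"] sublin_zero[OF sq] by simp
  have "q (c *\<^sub>R v) = c * q v" for c v
  proof (cases "0 \<le> c")
    case True then show ?thesis using sq unfolding sublin_def by blast
  next
    case False
    then have "q ((- c) *\<^sub>R v) = (- c) * q v"
      using sq unfolding sublin_def by (meson linorder_not_le neg_0_le_iff_le order_less_imp_le)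
    then show ?thesis using neg[of "c *\<^sub>R v"] by simp
  qed
  then have "linear q" using add by (intro linearI) auto
  then show ?thesis using q by blast
qed

theorem norming_functional:
  fixes w :: "'a::real_normed_vector"
  shows "\<exists>f. bounded_linear f \<and> (\<forall>x. \<bar>f x\<bar> \<le> norm x) \<and> f w = norm w"
proof -
  have n: "sublin (norm :: 'a \<Rightarrow> real)"
    unfolding sublin_def by (simp add: norm_triangle_ineq)
  obtain f where f: "linear f" and fle: "\<And>x. f x \<le> shrink norm w x"
    using sublin_dominates_linear[OF shrink_sublin[OF n]] by metis
  have le: "f x \<le> norm x" for x using fle shrink_le_self[OF n] by (meson order_trans)
  have abs: "\<bar>f x\<bar> \<le> norm x" for x
    using le[of x] le[of "- x"] linear_neg[OF f, of x] by simp
  have "f (- w) \<le> norm (- w + 1 *\<^sub>R w) - 1 * norm w"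
    using fle[of "- w"] shrink_le[OF n, of 1 w "- w"] by (meson order_trans zero_le_one)
  then have "f w = norm w" using le[of w] linear_neg[OF f, of w] by simp
  moreover have "bounded_linear f"
    using f abs by (intro bounded_linear_intro[where K = 1]) (auto simp: linear_add linear_scale)
  ultimately show ?thesis using abs by blast
qed

lemma finite_coordinates:
  fixes S :: "'a::real_normed_vector set"
  assumes "finite S"
  shows "\<exists>(n::nat) \<phi> e. (\<forall>i. bounded_linear (\<phi> i)) \<and> (\<forall>x\<in>S. x = (\<Sum>i<n. \<phi> i x *\<^sub>R e i))"
  using assms
proof (induction S rule: finite_induct)
  case empty
  show ?case by (rule exI[of _ 0], rule exI[of _ "\<lambda>_ _. 0"]) auto
next
  case (insert x S)
  then obtain n :: nat and \<phi> and e :: "nat \<Rightarrow> 'a" where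
    bl: "\<And>i. bounded_linear (\<phi> i)" and S: "\<And>x. x \<in> S \<Longrightarrow> x = (\<Sum>i<n. \<phi> i x *\<^sub>R e i)"
    by blast
  define P where "P v = (\<Sum>i<n. \<phi> i v *\<^sub>R e i)" for v
  have P: "bounded_linear P" unfolding P_def
    by (intro bounded_linear_sum bounded_linear_compose[OF bounded_linear_scaleR_left bl])
  define w where "w = x - P x"
  obtain f where f: "bounded_linear f" "f w = norm w" using norming_functional by blast
  define \<theta> where "\<theta> v = f (v - P v) / norm w" for v
  have \<theta>: "bounded_linear \<theta>" unfolding \<theta>_def
    by (intro bounded_linear_compose[OF bounded_linear_divide]
          bounded_linear_compose[OF f(1)] bounded_linear_sub bounded_linear_ident P)
  define \<phi>' where "\<phi>' i = (if i = n then \<theta> else \<phi> i)" for i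
  define e' where "e' i = (if i = n then w else e i)" for i
  have sum: "(\<Sum>i<Suc n. \<phi>' i v *\<^sub>R e' i) = P v + \<theta> v *\<^sub>R w" for v
    unfolding P_def \<phi>'_def e'_def by (auto intro!: sum.cong)
  have "v = P v + \<theta> v *\<^sub>R w" if "v \<in> insert x S" for v
  proof (cases "v \<in> S")
    case True
    then have "P v = v" using S unfolding P_def by metis
    then show ?thesis unfolding \<theta>_def by (simp add: linear_0[OF bounded_linear.linear[OF f(1)]])
  next
    case False
    then have v: "v = x" using that by simp
    show ?thesis
    proof (cases "w = 0")
      case True then show ?thesis using v w_def by simp
    next
      case False
      then have "\<theta> x = 1" unfolding \<theta>_def w_def[symmetric] using f(2) by simp
      then show ?thesis using v w_def by simp
    qed
  qed
  then have "\<forall>v\<in>insert x S. v = (\<Sum>i<Suc n. \<phi>' i v *\<^sub>R e' i)" using sum by metis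
  moreover have "\<forall>i. bounded_linear (\<phi>' i)" using bl \<theta> unfolding \<phi>'_def by simp
  ultimately show ?case by blast
qed


section \<open>The algebraic tensor product with the projective norm\<close>

text \<open>A list of pairs \<open>(x\<^sub>i, y\<^sub>i)\<close> stands for the formal sum of the \<open>x\<^sub>i \<otimes> y\<^sub>i\<close>. Two formal sums are
  the same tensor iff every bilinear form (no continuity required) takes the same value on them.\<close>

definition form_value :: "('a \<Rightarrow> 'b \<Rightarrow> real) \<Rightarrow> ('a \<times> 'b) list \<Rightarrow> real" where
  "form_value B l = (\<Sum>(x, y)\<leftarrow>l. B x y)"

definition tensor_eq ::
    "('a::real_vector \<times> 'b::real_vector) list \<Rightarrow> ('a \<times> 'b) list \<Rightarrow> bool" where
  "tensor_eq l m \<longleftrightarrow> (\<forall>B. bilinear B \<longrightarrow> form_value B l = form_value B m)"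

quotient_type (overloaded) ('a, 'b) atensor = "('a::real_vector \<times> 'b::real_vector) list" / tensor_eq
  by (rule equivpI) (auto simp: reflp_def symp_def transp_def tensor_eq_def)

lift_definition atensor :: "'a::real_vector \<Rightarrow> 'b::real_vector \<Rightarrow> ('a, 'b) atensor"
  is "\<lambda>x y. [(x, y)]" .

definition list_cost :: "('a::real_normed_vector \<times> 'b::real_normed_vector) list \<Rightarrow> real" where
  "list_cost l = (\<Sum>(x, y)\<leftarrow>l. norm x * norm y)"

lemma form_value_Nil [simp]: "form_value B [] = 0"
  and form_value_Cons [simp]: "form_value B (p # l) = B (fst p) (snd p) + form_value B l"
  and form_value_append [simp]: "form_value B (l @ m) = form_value B l + form_value B m"
  by (auto simp: form_value_def split: prod.split)

lemma list_cost_Nil [simp]: "list_cost [] = 0"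
  and list_cost_Cons [simp]: "list_cost (p # l) = norm (fst p) * norm (snd p) + list_cost l"
  and list_cost_append [simp]: "list_cost (l @ m) = list_cost l + list_cost m"
  by (auto simp: list_cost_def split: prod.split)

lemma form_value_scale:
  "bilinear B \<Longrightarrow> form_value B (map (\<lambda>(x, y). (c *\<^sub>R x, y)) l) = c * form_value B l"
  by (induction l) (auto simp: bilinear_lmul algebra_simps)

lemma list_cost_scale: "list_cost (map (\<lambda>(x, y). (c *\<^sub>R x, y)) l) = \<bar>c\<bar> * list_cost l"
  by (induction l) (auto simp: algebra_simps)

lemma list_cost_nonneg [simp]: "0 \<le> list_cost l"
  by (induction l) auto

instantiation atensor :: (real_vector, real_vector) real_vector
begin

lift_definition zero_atensor :: "('a, 'b) atensor" is "[]" .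

lift_definition plus_atensor :: "('a, 'b) atensor \<Rightarrow> ('a, 'b) atensor \<Rightarrow> ('a, 'b) atensor"
  is "(@)" by (auto simp: tensor_eq_def)

lift_definition scaleR_atensor :: "real \<Rightarrow> ('a, 'b) atensor \<Rightarrow> ('a, 'b) atensor"
  is "\<lambda>c. map (\<lambda>(x, y). (c *\<^sub>R x, y))" by (auto simp: tensor_eq_def form_value_scale)

lift_definition uminus_atensor :: "('a, 'b) atensor \<Rightarrow> ('a, 'b) atensor"
  is "map (\<lambda>(x, y). ((-1) *\<^sub>R x, y))" by (auto simp only: tensor_eq_def form_value_scale)

definition minus_atensor :: "('a, 'b) atensor \<Rightarrow> ('a, 'b) atensor \<Rightarrow> ('a, 'b) atensor"
  where "minus_atensor z w = z + - w"

instance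
proof
  fix a b c :: "('a, 'b) atensor" and r s :: real
  show "a + b + c = a + (b + c)" by transfer (auto simp: tensor_eq_def)
  show "a + b = b + a" by transfer (auto simp: tensor_eq_def)
  show "0 + a = a" by transfer (auto simp: tensor_eq_def)
  show "- a + a = 0"
  proof transfer
    fix l :: "('a \<times> 'b) list"
    have "form_value B (map (\<lambda>(x, y). ((-1) *\<^sub>R x, y)) l @ l) = 0" if "bilinear B" for B
      unfolding form_value_append form_value_scale[OF that] by simp
    then show "tensor_eq (map (\<lambda>(x, y). ((-1) *\<^sub>R x, y)) l @ l) []"
      by (simp only: tensor_eq_def form_value_Nil) blast
  qed
  show "a - b = a + - b" by (rule minus_atensor_def)
  show "r *\<^sub>R (a + b) = r *\<^sub>R a + r *\<^sub>R b" by transfer (auto simp: tensor_eq_def)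
  show "(r + s) *\<^sub>R a = r *\<^sub>R a + s *\<^sub>R a"
  proof transfer
    fix r s and l :: "('a \<times> 'b) list"
    have "form_value B (map (\<lambda>(x, y). ((r + s) *\<^sub>R x, y)) l) =
        form_value B (map (\<lambda>(x, y). (r *\<^sub>R x, y)) l @ map (\<lambda>(x, y). (s *\<^sub>R x, y)) l)"
      if "bilinear B" for B
      unfolding form_value_append form_value_scale[OF that] by (simp add: distrib_right)
    then show "tensor_eq (map (\<lambda>(x, y). ((r + s) *\<^sub>R x, y)) l)
        (map (\<lambda>(x, y). (r *\<^sub>R x, y)) l @ map (\<lambda>(x, y). (s *\<^sub>R x, y)) l)"
      by (simp only: tensor_eq_def) blast
  qed
  show "r *\<^sub>R s *\<^sub>R a = (r * s) *\<^sub>R a"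
    by transfer (simp add: tensor_eq_def form_value_scale del: map_map list.map_comp)
  show "1 *\<^sub>R a = a"
    by transfer (simp add: tensor_eq_def form_value_scale del: scaleR_one)
qed

end

lemma bilinear_atensor: "bilinear atensor"
  unfolding bilinear_def
proof (intro conjI allI linearI)
  fix x x' :: 'a and y y' :: 'b and c :: real
  show "atensor x (y + y') = atensor x y + atensor x y'"
    by transfer (simp add: tensor_eq_def bilinear_radd)
  show "atensor (x + x') y = atensor x y + atensor x' y"
    by transfer (simp add: tensor_eq_def bilinear_ladd)
  show "atensor x (c *\<^sub>R y) = c *\<^sub>R atensor x y"
    by transfer (simp add: tensor_eq_def bilinear_lmul bilinear_rmul)
  show "atensor (c *\<^sub>R x) y = c *\<^sub>R atensor x y"
    by transfer (simp add: tensor_eq_def)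
qed

lemma abs_atensor_sum: "abs_atensor l = (\<Sum>(x, y)\<leftarrow>l. atensor x y)"
proof (induction l)
  case Nil
  show ?case by (simp add: zero_atensor_def)
next
  case (Cons p l)
  have "abs_atensor (p # l) = atensor (fst p) (snd p) + abs_atensor l"
    by (simp add: atensor.abs_eq plus_atensor.abs_eq)
  then show ?case using Cons.IH by (simp add: case_prod_beta)
qed

text \<open>Testing against real-valued bilinear forms gives the universal property for bilinear maps
  into every real vector space.\<close>

lemma tensor_eq_bilinear:
  fixes h :: "'a::real_vector \<Rightarrow> 'b::real_vector \<Rightarrow> 'c::real_vector"
  assumes h: "bilinear h" and eq: "tensor_eq l m"
  shows "(\<Sum>(x, y)\<leftarrow>l. h x y) = (\<Sum>(x, y)\<leftarrow>m. h x y)" (is "?s l = ?s m")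
proof (rule ccontr)
  assume ne: "?s l \<noteq> ?s m"
  have "independent {?s l - ?s m}" using ne by (simp add: dependent_single)
  then obtain f :: "'c \<Rightarrow> real" where f: "linear f" "\<forall>v\<in>{?s l - ?s m}. f v = 1"
    using linear_independent_extend[of "{?s l - ?s m}" "\<lambda>_. 1"] by blast
  have "bilinear (\<lambda>x y. f (h x y))"
    unfolding bilinear_def
    by (auto intro!: linearI simp: bilinear_ladd[OF h] bilinear_radd[OF h] bilinear_lmul[OF h]
        bilinear_rmul[OF h] linear_add[OF f(1)] linear_scale[OF f(1)])
  then have "form_value (\<lambda>x y. f (h x y)) l = form_value (\<lambda>x y. f (h x y)) m"
    using eq unfolding tensor_eq_def by blast
  moreover have "form_value (\<lambda>x y. f (h x y)) k = f (?s k)" for k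
    by (induction k) (auto simp: linear_0[OF f(1)] linear_add[OF f(1)])
  ultimately show False using f linear_diff[OF f(1)] by simp
qed

theorem atensor_universal:
  fixes h :: "'a::real_vector \<Rightarrow> 'b::real_vector \<Rightarrow> 'c::real_vector"
  assumes h: "bilinear h"
  shows "\<exists>!T. linear T \<and> (\<forall>x y. T (atensor x y) = h x y)"
proof (rule ex_ex1I)
  define T where "T z = (\<Sum>(x, y)\<leftarrow>rep_atensor z. h x y)" for z
  have T: "T (abs_atensor l) = (\<Sum>(x, y)\<leftarrow>l. h x y)" for l
    unfolding T_def by (rule tensor_eq_bilinear[OF h])
      (simp add: atensor.abs_eq_iff[symmetric] Quotient_abs_rep[OF Quotient_atensor])
  have scale: "(\<Sum>(x, y)\<leftarrow>map (\<lambda>(x, y). (c *\<^sub>R x, y)) l. h x y) = c *\<^sub>R (\<Sum>(x, y)\<leftarrow>l. h x y)" for c l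
    by (induction l) (auto simp: bilinear_lmul[OF h] scaleR_add_right)
  have "linear T"
  proof (rule linearI)
    fix z w :: "('a, 'b) atensor" and c :: real
    obtain l m where lm: "z = abs_atensor l" "w = abs_atensor m"
      by (metis Quotient_abs_rep[OF Quotient_atensor])
    show "T (z + w) = T z + T w" unfolding lm plus_atensor.abs_eq T by simp
    show "T (c *\<^sub>R z) = c *\<^sub>R T z" unfolding lm scaleR_atensor.abs_eq T scale ..
  qed
  moreover have "T (atensor x y) = h x y" for x y unfolding atensor.abs_eq T by simp
  ultimately show "\<exists>T. linear T \<and> (\<forall>x y. T (atensor x y) = h x y)" by blast
next
  fix T S :: "('a, 'b) atensor \<Rightarrow> 'c"
  assume T: "linear T \<and> (\<forall>x y. T (atensor x y) = h x y)"
    and S: "linear S \<and> (\<forall>x y. S (atensor x y) = h x y)"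
  have "T (abs_atensor l) = S (abs_atensor l)" for l
    unfolding abs_atensor_sum using T S
    by (induction l) (auto simp: linear_0 linear_add)
  then have "T (abs_atensor (rep_atensor z)) = S (abs_atensor (rep_atensor z))" for z .
  then show "T = S" unfolding Quotient_abs_rep[OF Quotient_atensor] by (rule ext)
qed

lemma form_value_expand:
  assumes B: "bilinear B"
    and x: "\<And>x y. (x, y) \<in> set l \<Longrightarrow> x = (\<Sum>i<m. \<phi> i x *\<^sub>R e i)"
    and y: "\<And>x y. (x, y) \<in> set l \<Longrightarrow> y = (\<Sum>j<n. \<psi> j y *\<^sub>R d j)"
  shows "form_value B l =
    (\<Sum>i<m. \<Sum>j<n. B (e i) (d j) * form_value (\<lambda>x y. \<phi> i x * \<psi> j y) l)"
  using x y
proof (induction l)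
  case Nil
  show ?case by simp
next
  case (Cons p l)
  obtain x y where p: "p = (x, y)" by fastforce
  have lin: "linear (\<lambda>x. B x y)" "linear (B x)" for x y
    using B unfolding bilinear_def by auto
  have "B x y = B (\<Sum>i<m. \<phi> i x *\<^sub>R e i) (\<Sum>j<n. \<psi> j y *\<^sub>R d j)"
    using Cons.prems[of x y] p by simp
  also have "\<dots> = (\<Sum>i<m. \<Sum>j<n. B (e i) (d j) * (\<phi> i x * \<psi> j y))"
    unfolding linear_sum[OF lin(1)] linear_sum[OF lin(2)]
    by (subst sum.swap) (simp add: linear_sum[OF lin(1)] bilinear_lmul[OF B] bilinear_rmul[OF B] algebra_simps)
  finally have "B x y = (\<Sum>i<m. \<Sum>j<n. B (e i) (d j) * (\<phi> i x * \<psi> j y))" .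
  moreover have "form_value B l =
      (\<Sum>i<m. \<Sum>j<n. B (e i) (d j) * form_value (\<lambda>x y. \<phi> i x * \<psi> j y) l)"
    by (rule Cons.IH) (use Cons.prems in auto)
  ultimately show ?case using p by (simp add: sum.distrib distrib_left)
qed

lemma separating_product_functional:
  fixes l :: "('a::real_normed_vector \<times> 'b::real_normed_vector) list"
  assumes B: "bilinear B" and ne: "form_value B l \<noteq> 0"
  shows "\<exists>\<phi> \<psi>. bounded_linear \<phi> \<and> bounded_linear \<psi> \<and> form_value (\<lambda>x y. \<phi> x * \<psi> y) l \<noteq> 0"
proof (rule ccontr)
  assume "\<not> ?thesis"
  then have zero: "form_value (\<lambda>x y. \<phi> x * \<psi> y) l = 0"
    if "bounded_linear \<phi>" "bounded_linear \<psi>" for \<phi> \<psi> using that by blast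
  obtain m :: nat and \<phi> and e :: "nat \<Rightarrow> 'a" where \<phi>: "\<And>i. bounded_linear (\<phi> i)"
    and x: "\<And>x. x \<in> fst ` set l \<Longrightarrow> x = (\<Sum>i<m. \<phi> i x *\<^sub>R e i)"
    using finite_coordinates[OF finite_imageI[OF finite_set], of fst l] by metis
  obtain n :: nat and \<psi> and d :: "nat \<Rightarrow> 'b" where \<psi>: "\<And>i. bounded_linear (\<psi> i)"
    and y: "\<And>y. y \<in> snd ` set l \<Longrightarrow> y = (\<Sum>i<n. \<psi> i y *\<^sub>R d i)"
    using finite_coordinates[OF finite_imageI[OF finite_set], of snd l] by metis
  have "form_value B l =
      (\<Sum>i<m. \<Sum>j<n. B (e i) (d j) * form_value (\<lambda>x y. \<phi> i x * \<psi> j y) l)"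
    by (rule form_value_expand[OF B]) (use x y in force)+
  then show False using ne zero[OF \<phi> \<psi>] by simp
qed

instantiation atensor :: (real_normed_vector, real_normed_vector) real_normed_vector
begin

lift_definition norm_atensor :: "('a, 'b) atensor \<Rightarrow> real"
  is "\<lambda>l. Inf {list_cost m | m. tensor_eq l m}"
  unfolding tensor_eq_def by simp

definition sgn_atensor :: "('a, 'b) atensor \<Rightarrow> ('a, 'b) atensor"
  where "sgn_atensor z = inverse (norm z) *\<^sub>R z"

definition dist_atensor :: "('a, 'b) atensor \<Rightarrow> ('a, 'b) atensor \<Rightarrow> real"
  where "dist_atensor z w = norm (z - w)"

definition uniformity_atensor :: "(('a, 'b) atensor \<times> ('a, 'b) atensor) filter"
  where "uniformity_atensor = (INF e\<in>{0 <..}. principal {(z, w). dist z w < e})"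

definition open_atensor :: "('a, 'b) atensor set \<Rightarrow> bool"
  where "open_atensor U \<longleftrightarrow>
    (\<forall>z\<in>U. eventually (\<lambda>(z', w). z' = z \<longrightarrow> w \<in> U) uniformity)"

lemma norm_atensor_Inf:
  fixes z :: "('a, 'b) atensor"
  shows "norm z = Inf {list_cost m | m. abs_atensor m = z}"
proof transfer
  fix l :: "('a \<times> 'b) list"
  show "Inf {list_cost m | m. tensor_eq l m} = Inf {list_cost m | m. tensor_eq m l}"
    by (metis tensor_eq_def)
qed

lemma norm_atensor_le: "norm (abs_atensor m :: ('a, 'b) atensor) \<le> list_cost m"
  unfolding norm_atensor_Inf by (rule cInf_lower) (auto intro!: bdd_belowI[of _ 0])

lemma norm_atensor_greatest:
  fixes z :: "('a, 'b) atensor"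
  assumes "\<And>m. abs_atensor m = z \<Longrightarrow> c \<le> list_cost m"
  shows "c \<le> norm z"
  unfolding norm_atensor_Inf
proof (rule cInf_greatest)
  have "abs_atensor (rep_atensor z) = z"
    by (rule Quotient_abs_rep[OF Quotient_atensor])
  then show "{list_cost m | m. abs_atensor m = z} \<noteq> {}" by blast
qed (use assms in auto)

instance
proof
  fix z w :: "('a, 'b) atensor" and c :: real
  show "dist z w = norm (z - w)" by (rule dist_atensor_def)
  show "sgn z = inverse (norm z) *\<^sub>R z" by (rule sgn_atensor_def)
  show "uniformity = (INF e\<in>{0 <..}. principal {(z, w :: ('a, 'b) atensor). dist z w < e})"
    by (rule uniformity_atensor_def)
  show "open U \<longleftrightarrow> (\<forall>z\<in>U. eventually (\<lambda>(z', w). z' = z \<longrightarrow> w \<in> U) uniformity)"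
    for U :: "('a, 'b) atensor set" by (rule open_atensor_def)
  have nn: "0 \<le> norm z" for z :: "('a, 'b) atensor" by (rule norm_atensor_greatest) simp
  show "norm (z + w) \<le> norm z + norm w"
  proof -
    have *: "norm (z + w) \<le> list_cost l + list_cost m"
      if "abs_atensor l = z" "abs_atensor m = w" for l m
      using norm_atensor_le[of "l @ m"] that by (simp add: plus_atensor.abs_eq[symmetric])
    have "norm (z + w) - list_cost l \<le> norm w" if "abs_atensor l = z" for l
      by (rule norm_atensor_greatest) (use *[OF that] in \<open>simp add: algebra_simps\<close>)
    then have "norm (z + w) - norm w \<le> norm z"
      by (intro norm_atensor_greatest) (smt (verit))
    then show ?thesis by simp
  qed
  have le: "norm (c *\<^sub>R z) \<le> \<bar>c\<bar> * norm z" for c and z :: "('a, 'b) atensor"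
  proof (cases "c = 0")
    case True
    have "norm (0 :: ('a, 'b) atensor) \<le> 0"
      using norm_atensor_le[of "[]"] by (simp add: zero_atensor_def)
    then show ?thesis using True by simp
  next
    case False
    have "norm (c *\<^sub>R z) / \<bar>c\<bar> \<le> norm z"
    proof (rule norm_atensor_greatest)
      fix m assume "abs_atensor m = z"
      then have "norm (c *\<^sub>R z) \<le> \<bar>c\<bar> * list_cost m"
        using norm_atensor_le[of "map (\<lambda>(x, y). (c *\<^sub>R x, y)) m"]
        by (auto simp: scaleR_atensor.abs_eq[symmetric] list_cost_scale)
      then show "norm (c *\<^sub>R z) / \<bar>c\<bar> \<le> list_cost m" using False by (simp add: field_simps)
    qed
    then show ?thesis using False by (simp add: field_simps)
  qed
  show "norm (c *\<^sub>R z) = \<bar>c\<bar> * norm z"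
  proof (cases "c = 0")
    case True
    then show ?thesis using le[of 0 z] nn[of 0] by simp
  next
    case False
    then have "norm z \<le> \<bar>inverse c\<bar> * norm (c *\<^sub>R z)" using le[of "inverse c" "c *\<^sub>R z"] by simp
    then have "\<bar>c\<bar> * norm z \<le> norm (c *\<^sub>R z)" using False by (simp add: field_simps)
    then show ?thesis using le[of c z] by simp
  qed
  have "z = 0" if n0: "norm z = 0"
  proof (rule ccontr)
    assume z: "z \<noteq> 0"
    obtain l where l: "abs_atensor l = z" using Quotient_abs_rep[OF Quotient_atensor] by blast
    then have "\<not> tensor_eq l []" using z by (auto simp: zero_atensor_def atensor.abs_eq_iff)
    then obtain B where "bilinear B" "form_value B l \<noteq> 0" unfolding tensor_eq_def by auto
    then obtain \<phi> \<psi> where bl: "bounded_linear \<phi>" "bounded_linear \<psi>"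
      and ne: "form_value (\<lambda>x y. \<phi> x * \<psi> y) l \<noteq> 0" (is "?v l \<noteq> 0")
      using separating_product_functional by blast
    obtain K1 K2 where K: "0 < K1" "\<And>x. \<bar>\<phi> x\<bar> \<le> norm x * K1"
        "0 < K2" "\<And>y. \<bar>\<psi> y\<bar> \<le> norm y * K2"
      using bounded_linear.pos_bounded[OF bl(1)] bounded_linear.pos_bounded[OF bl(2)]
      by (auto simp: real_norm_def)
    have "bilinear (\<lambda>x y. \<phi> x * \<psi> y)"
      unfolding bilinear_def using bl
      by (auto intro!: linearI simp: bounded_linear.linear linear_add linear_scale algebra_simps)
    then have eq: "?v m = ?v l" if "abs_atensor m = z" for m
      using that l by (auto simp: atensor.abs_eq_iff tensor_eq_def)
    have bound: "\<bar>?v m\<bar> \<le> (K1 * K2) * list_cost m" for m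
    proof (induction m)
      case (Cons p m)
      have "\<bar>\<phi> (fst p) * \<psi> (snd p)\<bar> \<le> (norm (fst p) * K1) * (norm (snd p) * K2)"
        unfolding abs_mult by (intro mult_mono K) (use K in auto)
      then show ?case using Cons.IH by (simp add: algebra_simps abs_if split: if_splits)
    qed simp
    have "\<bar>?v l\<bar> / (K1 * K2) \<le> norm z"
    proof (rule norm_atensor_greatest)
      fix m assume "abs_atensor m = z"
      then have "\<bar>?v l\<bar> \<le> (K1 * K2) * list_cost m" using bound[of m] eq by simp
      then show "\<bar>?v l\<bar> / (K1 * K2) \<le> list_cost m"
        using mult_pos_pos[OF K(1,3)] by (simp add: pos_divide_le_eq mult.commute)
    qed
    moreover have "0 < \<bar>?v l\<bar> / (K1 * K2)" using ne K by simp
    ultimately show False using n0 by simp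
  qed
  moreover have "norm (0 :: ('a, 'b) atensor) = 0"
    using norm_atensor_le[of "[]"] nn[of 0] by (simp add: zero_atensor_def)
  ultimately show "norm z = 0 \<longleftrightarrow> z = 0" by auto
qed

end


section \<open>Completion of a normed space\<close>

definition cauchy_eq :: "(nat \<Rightarrow> 'a::real_normed_vector) \<Rightarrow> (nat \<Rightarrow> 'a) \<Rightarrow> bool" where
  "cauchy_eq X Y \<longleftrightarrow> Cauchy X \<and> Cauchy Y \<and> (\<lambda>n. X n - Y n) \<longlonglongrightarrow> 0"

lemma cauchy_eq_refl: "Cauchy X \<Longrightarrow> cauchy_eq X X"
  by (simp add: cauchy_eq_def)

lemma Cauchy_add_normed:
  fixes X Y :: "nat \<Rightarrow> 'a::real_normed_vector"
  assumes "Cauchy X" "Cauchy Y"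
  shows "Cauchy (\<lambda>n. X n + Y n)"
proof (rule metric_CauchyI)
  fix e :: real assume e: "0 < e"
  obtain M where M: "\<And>m n. M \<le> m \<Longrightarrow> M \<le> n \<Longrightarrow> dist (X m) (X n) < e/2"
    using metric_CauchyD[OF assms(1), of "e/2"] e by auto
  obtain N where N: "\<And>m n. N \<le> m \<Longrightarrow> N \<le> n \<Longrightarrow> dist (Y m) (Y n) < e/2"
    using metric_CauchyD[OF assms(2), of "e/2"] e by auto
  have "dist (X m + Y m) (X n + Y n) < e" if "max M N \<le> m" "max M N \<le> n" for m n
    using dist_triangle_add[of "X m" "Y m" "X n" "Y n"] M[of m n] N[of m n] that by simp
  then show "\<exists>M. \<forall>m\<ge>M. \<forall>n\<ge>M. dist (X m + Y m) (X n + Y n) < e" by blast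
qed

lemma Cauchy_norm_convergent:
  fixes X :: "nat \<Rightarrow> 'a::real_normed_vector"
  assumes "Cauchy X"
  shows "convergent (\<lambda>n. norm (X n))"
proof (rule Cauchy_convergent, rule metric_CauchyI)
  fix e :: real assume "0 < e"
  then obtain M where "\<forall>m\<ge>M. \<forall>n\<ge>M. dist (X m) (X n) < e"
    using assms by (meson metric_CauchyD)
  then show "\<exists>M. \<forall>m\<ge>M. \<forall>n\<ge>M. dist (norm (X m)) (norm (X n)) < e"
    by (metis dist_norm dist_real_def norm_triangle_ineq3 order_le_less_trans)
qed

quotient_type (overloaded) 'a completion = "nat \<Rightarrow> 'a::real_normed_vector" / partial: cauchy_eq
proof (rule part_equivpI)
  show "\<exists>X :: nat \<Rightarrow> 'a. cauchy_eq X X" using cauchy_eq_refl[OF convergent_Cauchy[OF convergent_const]] by blast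
  show "symp (cauchy_eq :: _ \<Rightarrow> (nat \<Rightarrow> 'a) \<Rightarrow> bool)"
  proof (rule sympI)
    fix X Y :: "nat \<Rightarrow> 'a" assume "cauchy_eq X Y"
    then show "cauchy_eq Y X" unfolding cauchy_eq_def
      using tendsto_minus[of "\<lambda>n. X n - Y n" 0 sequentially] by simp
  qed
  show "transp (cauchy_eq :: _ \<Rightarrow> (nat \<Rightarrow> 'a) \<Rightarrow> bool)"
  proof (rule transpI)
    fix X Y Z :: "nat \<Rightarrow> 'a" assume "cauchy_eq X Y" "cauchy_eq Y Z"
    then show "cauchy_eq X Z" unfolding cauchy_eq_def
      using tendsto_add[of "\<lambda>n. X n - Y n" 0 sequentially "\<lambda>n. Y n - Z n" 0] by simp
  qed
qed

lift_definition to_completion :: "'a::real_normed_vector \<Rightarrow> 'a completion"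
  is "\<lambda>x n. x" by (simp add: cauchy_eq_refl convergent_Cauchy convergent_const)

instantiation completion :: (real_normed_vector) real_vector
begin

lift_definition zero_completion :: "'a completion" is "\<lambda>n. 0"
  by (simp add: cauchy_eq_refl convergent_Cauchy convergent_const)

lift_definition plus_completion :: "'a completion \<Rightarrow> 'a completion \<Rightarrow> 'a completion"
  is "\<lambda>X Y n. X n + Y n"
proof -
  fix X X' Y Y' :: "nat \<Rightarrow> 'a" assume "cauchy_eq X X'" "cauchy_eq Y Y'"
  then show "cauchy_eq (\<lambda>n. X n + Y n) (\<lambda>n. X' n + Y' n)"
    unfolding cauchy_eq_def
    using tendsto_add[of "\<lambda>n. X n - X' n" 0 sequentially "\<lambda>n. Y n - Y' n" 0]
    by (simp add: Cauchy_add_normed add_diff_add)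
qed

lift_definition scaleR_completion :: "real \<Rightarrow> 'a completion \<Rightarrow> 'a completion"
  is "\<lambda>c X n. c *\<^sub>R X n"
proof -
  fix c and X X' :: "nat \<Rightarrow> 'a" assume "cauchy_eq X X'"
  then show "cauchy_eq (\<lambda>n. c *\<^sub>R X n) (\<lambda>n. c *\<^sub>R X' n)"
    unfolding cauchy_eq_def
    using tendsto_scaleR[OF tendsto_const[of c], of "\<lambda>n. X n - X' n" 0 sequentially]
    by (simp add: bounded_linear.Cauchy[OF bounded_linear_scaleR_right] scaleR_diff_right)
qed

definition uminus_completion :: "'a completion \<Rightarrow> 'a completion"
  where "uminus_completion z = (-1) *\<^sub>R z"

definition minus_completion :: "'a completion \<Rightarrow> 'a completion \<Rightarrow> 'a completion"
  where "minus_completion z w = z + (-1) *\<^sub>R w"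

instance
proof
  have C: "Cauchy (\<lambda>n. r *\<^sub>R X n)" if "Cauchy X" for r and X :: "nat \<Rightarrow> 'a"
    using that by (rule bounded_linear.Cauchy[OF bounded_linear_scaleR_right])
  note C = this Cauchy_add_normed convergent_Cauchy[OF convergent_const]
  fix a b c :: "'a completion" and r s :: real
  show "a + b + c = a + (b + c)" by transfer (auto simp: cauchy_eq_def C add.assoc)
  show "a + b = b + a" by transfer (auto simp: cauchy_eq_def C)
  show "0 + a = a" by transfer (auto simp: cauchy_eq_def C)
  show "- a + a = 0" unfolding uminus_completion_def by transfer (auto simp: cauchy_eq_def C)
  show "a - b = a + - b" unfolding minus_completion_def uminus_completion_def by simp
  show "r *\<^sub>R (a + b) = r *\<^sub>R a + r *\<^sub>R b"
    by transfer (auto simp: cauchy_eq_def C scaleR_add_right)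
  show "(r + s) *\<^sub>R a = r *\<^sub>R a + s *\<^sub>R a"
    by transfer (auto simp: cauchy_eq_def C scaleR_add_left)
  show "r *\<^sub>R s *\<^sub>R a = (r * s) *\<^sub>R a" by transfer (auto simp: cauchy_eq_def C)
  show "1 *\<^sub>R a = a" by transfer (auto simp: cauchy_eq_def C)
qed

end

instantiation completion :: (real_normed_vector) real_normed_vector
begin

lift_definition norm_completion :: "'a completion \<Rightarrow> real" is "\<lambda>X. lim (\<lambda>n. norm (X n))"
proof -
  fix X Y :: "nat \<Rightarrow> 'a" assume XY: "cauchy_eq X Y"
  have "(\<lambda>n. norm (X n) - norm (Y n)) \<longlonglongrightarrow> 0"
    by (rule Lim_null_comparison[of _ "\<lambda>n. norm (X n - Y n)"])
      (use XY in \<open>auto simp: cauchy_eq_def norm_triangle_ineq3 intro: tendsto_norm_zero\<close>)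
  moreover have "(\<lambda>n. norm (Y n)) \<longlonglongrightarrow> lim (\<lambda>n. norm (Y n))"
    using XY Cauchy_norm_convergent unfolding cauchy_eq_def convergent_LIMSEQ_iff by blast
  ultimately have "(\<lambda>n. norm (X n)) \<longlonglongrightarrow> lim (\<lambda>n. norm (Y n))"
    using tendsto_add by fastforce
  then show "lim (\<lambda>n. norm (X n)) = lim (\<lambda>n. norm (Y n))" by (rule limI)
qed

definition sgn_completion :: "'a completion \<Rightarrow> 'a completion"
  where "sgn_completion z = inverse (norm z) *\<^sub>R z"

definition dist_completion :: "'a completion \<Rightarrow> 'a completion \<Rightarrow> real"
  where "dist_completion z w = norm (z - w)"

definition uniformity_completion :: "('a completion \<times> 'a completion) filter"
  where "uniformity_completion = (INF e\<in>{0 <..}. principal {(z, w). dist z w < e})"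

definition open_completion :: "'a completion set \<Rightarrow> bool"
  where "open_completion U \<longleftrightarrow>
    (\<forall>z\<in>U. eventually (\<lambda>(z', w). z' = z \<longrightarrow> w \<in> U) uniformity)"

instance
proof
  have L: "(\<lambda>n. norm (X n)) \<longlonglongrightarrow> lim (\<lambda>n. norm (X n))" if "cauchy_eq X X" for X :: "nat \<Rightarrow> 'a"
    using that Cauchy_norm_convergent unfolding cauchy_eq_def convergent_LIMSEQ_iff by blast
  fix z w :: "'a completion" and c :: real
  show "dist z w = norm (z - w)" by (rule dist_completion_def)
  show "sgn z = inverse (norm z) *\<^sub>R z" by (rule sgn_completion_def)
  show "uniformity = (INF e\<in>{0 <..}. principal {(z, w :: 'a completion). dist z w < e})"
    by (rule uniformity_completion_def)
  show "open U \<longleftrightarrow> (\<forall>z\<in>U. eventually (\<lambda>(z', w). z' = z \<longrightarrow> w \<in> U) uniformity)"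
    for U :: "'a completion set" by (rule open_completion_def)
  show "norm (z + w) \<le> norm z + norm w"
  proof transfer
    fix X Y :: "nat \<Rightarrow> 'a" assume XY: "cauchy_eq X X" "cauchy_eq Y Y"
    then have "cauchy_eq (\<lambda>n. X n + Y n) (\<lambda>n. X n + Y n)"
      by (simp add: cauchy_eq_def Cauchy_add_normed)
    from L[OF this] tendsto_add[OF L[OF XY(1)] L[OF XY(2)]]
    show "lim (\<lambda>n. norm (X n + Y n)) \<le> lim (\<lambda>n. norm (X n)) + lim (\<lambda>n. norm (Y n))"
      by (rule LIMSEQ_le) (simp add: norm_triangle_ineq)
  qed
  show "norm (c *\<^sub>R z) = \<bar>c\<bar> * norm z"
  proof transfer
    fix c and X :: "nat \<Rightarrow> 'a" assume "cauchy_eq X X"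
    from tendsto_mult[OF tendsto_const L[OF this]]
    show "lim (\<lambda>n. norm (c *\<^sub>R X n)) = \<bar>c\<bar> * lim (\<lambda>n. norm (X n))"
      by (intro limI) simp
  qed
  show "norm z = 0 \<longleftrightarrow> z = 0"
  proof transfer
    fix X :: "nat \<Rightarrow> 'a" assume X: "cauchy_eq X X"
    have "lim (\<lambda>n. norm (X n)) = 0 \<longleftrightarrow> (\<lambda>n. norm (X n)) \<longlonglongrightarrow> 0"
      using L[OF X] by (metis limI)
    then show "lim (\<lambda>n. norm (X n)) = 0 \<longleftrightarrow> cauchy_eq X (\<lambda>n. 0)"
      using X by (simp add: cauchy_eq_def tendsto_norm_zero_iff convergent_Cauchy convergent_const)
  qed
qed

end

lemma norm_to_completion [simp]: "norm (to_completion x) = norm x"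
  by transfer simp

lemma to_completion_tendsto:
  assumes X: "Cauchy X"
  shows "(\<lambda>n. to_completion (X n)) \<longlonglongrightarrow> abs_completion X"
proof (rule metric_LIMSEQ_I)
  fix e :: real assume e: "0 < e"
  obtain N where N: "\<And>m n. N \<le> m \<Longrightarrow> N \<le> n \<Longrightarrow> dist (X m) (X n) < e/2"
    using metric_CauchyD[OF X, of "e/2"] e by auto
  have "dist (to_completion (X m)) (abs_completion X) < e" if m: "N \<le> m" for m
  proof -
    have CX: "Cauchy (\<lambda>n. (-1) *\<^sub>R X n)"
      using X by (rule bounded_linear.Cauchy[OF bounded_linear_scaleR_right])
    have CD: "Cauchy (\<lambda>n. X m + (-1) *\<^sub>R X n)"
      by (rule Cauchy_add_normed[OF convergent_Cauchy[OF convergent_const] CX])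
    have "to_completion (X m) - abs_completion X = abs_completion (\<lambda>n. X m + (-1) *\<^sub>R X n)"
      unfolding minus_completion_def to_completion.abs_eq
        scaleR_completion.abs_eq[OF cauchy_eq_refl[OF X]]
      by (rule plus_completion.abs_eq)
        (intro cauchy_eq_refl convergent_Cauchy convergent_const CX)+
    then have eq: "dist (to_completion (X m)) (abs_completion X) = lim (\<lambda>n. norm (X m - X n))"
      using norm_completion.abs_eq[OF cauchy_eq_refl[OF CD]] by (simp add: dist_norm)
    have "(\<lambda>n. norm (X m - X n)) \<longlonglongrightarrow> lim (\<lambda>n. norm (X m - X n))"
      using Cauchy_norm_convergent[OF CD] by (simp add: convergent_LIMSEQ_iff)
    then have "lim (\<lambda>n. norm (X m - X n)) \<le> e/2"
      by (rule LIMSEQ_le_const2) (use N[OF m] in \<open>auto simp: dist_norm intro!: exI[of _ N] less_imp_le\<close>)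
    then show ?thesis using eq e by simp
  qed
  then show "\<exists>N. \<forall>n\<ge>N. dist (to_completion (X n)) (abs_completion X) < e" by blast
qed

lemma to_completion_dense: "0 < e \<Longrightarrow> \<exists>x. dist z (to_completion x) < e"
proof -
  assume e: "0 < e"
  obtain X where X: "Cauchy X" "abs_completion X = z"
    by (metis Quotient_abs_rep[OF Quotient_completion] Quotient_rep_reflp[OF Quotient_completion] cauchy_eq_def)
  then obtain n where "dist (to_completion (X n)) z < e"
    using metric_LIMSEQ_D[OF to_completion_tendsto e] by blast
  then show ?thesis by (metis dist_commute)
qed

lemma to_completion_diff: "to_completion (x - y) = to_completion x - to_completion y"
  unfolding minus_completion_def
  by transfer (simp add: cauchy_eq_refl convergent_Cauchy convergent_const)

instance completion :: (real_normed_vector) banach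
proof
  fix Z :: "nat \<Rightarrow> 'a completion" assume Z: "Cauchy Z"
  have "\<exists>x. dist (Z n) (to_completion x) < inverse (real (Suc n))" for n
    by (rule to_completion_dense) simp
  then obtain a where a: "\<And>n. dist (Z n) (to_completion (a n)) < inverse (real (Suc n))" by metis
  have lim0: "(\<lambda>n. dist (Z n) (to_completion (a n))) \<longlonglongrightarrow> 0"
    by (rule Lim_null_comparison[OF _ LIMSEQ_inverse_real_of_nat])
      (use a in \<open>auto intro!: always_eventually less_imp_le\<close>)
  have iso: "dist (a m) (a n) = dist (to_completion (a m)) (to_completion (a n))" for m n
    by (simp add: dist_norm to_completion_diff[symmetric])
  have "Cauchy a"
  proof (rule metric_CauchyI)
    fix e :: real assume e: "0 < e"
    obtain M where M: "\<And>m n. M \<le> m \<Longrightarrow> M \<le> n \<Longrightarrow> dist (Z m) (Z n) < e/3"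
      using metric_CauchyD[OF Z, of "e/3"] e by auto
    obtain N where N: "\<And>n. N \<le> n \<Longrightarrow> dist (Z n) (to_completion (a n)) < e/3"
      using metric_LIMSEQ_D[OF lim0, of "e/3"] e by auto
    have "dist (a m) (a n) < e" if "max M N \<le> m" "max M N \<le> n" for m n
    proof -
      have "dist (a m) (a n) \<le> dist (to_completion (a m)) (Z m) + dist (Z m) (Z n)
          + dist (Z n) (to_completion (a n))"
        unfolding iso by (smt (verit) dist_triangle)
      also have "\<dots> < e"
        using M[of m n] N[of m] N[of n] that by (simp add: dist_commute)
      finally show ?thesis .
    qed
    then show "\<exists>M. \<forall>m\<ge>M. \<forall>n\<ge>M. dist (a m) (a n) < e" by blast
  qed
  then have "(\<lambda>n. to_completion (a n)) \<longlonglongrightarrow> abs_completion a" by (rule to_completion_tendsto)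
  then have "Z \<longlonglongrightarrow> abs_completion a"
  proof (rule Lim_transform2)
    have "(\<lambda>n. norm (to_completion (a n) - Z n)) \<longlonglongrightarrow> 0"
      using lim0 by (simp add: dist_norm norm_minus_commute)
    then show "(\<lambda>n. to_completion (a n) - Z n) \<longlonglongrightarrow> 0" by (simp add: tendsto_norm_zero_iff)
  qed
  then show "convergent Z" by (auto simp: convergent_def)
qed


section \<open>The projective tensor product and norm attainment\<close>

type_synonym ('a, 'b) ptensor = "('a, 'b) atensor completion"

definition tensor ::
    "'a::real_normed_vector \<Rightarrow> 'b::real_normed_vector \<Rightarrow> ('a, 'b) ptensor"
    (infixl "\<otimes>\<^sub>\<pi>" 75)
  where "x \<otimes>\<^sub>\<pi> y = to_completion (atensor x y)"

definition attains_projective_norm ::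
    "('a::real_normed_vector, 'b::real_normed_vector) ptensor \<Rightarrow> bool" where
  "attains_projective_norm z \<longleftrightarrow>
    (\<exists>(x :: nat \<Rightarrow> 'a) (y :: nat \<Rightarrow> 'b).
      (\<lambda>n. norm (x n) * norm (y n)) sums norm z \<and> (\<lambda>n. x n \<otimes>\<^sub>\<pi> y n) sums z)"

definition NA :: "('a::real_normed_vector, 'b::real_normed_vector) ptensor set" where
  "NA = {z. attains_projective_norm z}"

definition dense :: "'a::topological_space set \<Rightarrow> bool" where
  "dense S \<longleftrightarrow> closure S = UNIV"


section \<open>Conditions on Banach spaces\<close>

definition finite_dimensional :: "'a::real_vector set \<Rightarrow> bool" where
  "finite_dimensional M \<longleftrightarrow> (\<exists>B. finite B \<and> M = span B)"

definition infinite_dimensional :: "'a::real_vector itself \<Rightarrow> bool" where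
  "infinite_dimensional _ \<longleftrightarrow> \<not> finite_dimensional (UNIV :: 'a set)"

text \<open>\<^const>\<open>Euclidean_space\<close> is the library's \<open>\<real>\<^sup>N\<close> for a variable \<open>N\<close>: the real sequences that
  vanish from index \<open>N\<close> on.\<close>

definition locally_finitely_many_coordinates :: "'a::real_normed_vector itself \<Rightarrow> bool" where
  "locally_finitely_many_coordinates _ \<longleftrightarrow>
    (\<forall>x::'a. x \<noteq> 0 \<longrightarrow>
      (\<exists>\<epsilon>>0. \<exists>(N::nat) (f :: nat \<Rightarrow> 'a \<Rightarrow>\<^sub>L real) \<phi>.
        continuous_map (Euclidean_space N) euclideanreal \<phi> \<and>
        (\<forall>y. norm (y - x) < \<epsilon> \<longrightarrow> norm y = \<phi> (\<lambda>i. if i < N then f i y else 0))))"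

definition one_complemented :: "'a::real_normed_vector set \<Rightarrow> bool" where
  "one_complemented M \<longleftrightarrow>
    (\<exists>P :: 'a \<Rightarrow>\<^sub>L 'a. P o\<^sub>L P = P \<and> norm P \<le> 1 \<and> range (blinfun_apply P) = M)"

definition metric_pi_property :: "'a::real_normed_vector itself \<Rightarrow> bool" where
  "metric_pi_property _ \<longleftrightarrow>
    (\<forall>\<epsilon>>0. \<forall>F :: 'a set. finite F \<and> F \<subseteq> sphere 0 1 \<longrightarrow>
      (\<exists>M. finite_dimensional M \<and> one_complemented M \<and>
        (\<forall>x\<in>F. \<exists>x'\<in>M. norm (x - x') < \<epsilon>)))"


section \<open>The space of families vanishing at infinity\<close>

text \<open>The index set is a whole type \<open>'i\<close>; \<^const>\<open>cofinite\<close> convergence to \<open>0\<close> is vanishing at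
  infinity on the discrete space \<open>'i\<close>.\<close>

typedef 'i c0 = "{f :: 'i \<Rightarrow> real. (f \<longlongrightarrow> 0) cofinite}"
  morphisms c0_apply Abs_c0
  by (rule exI[of _ "\<lambda>_. 0"]) simp

setup_lifting type_definition_c0

lemma c0_bounded:
  assumes "((f :: 'i \<Rightarrow> real) \<longlongrightarrow> 0) cofinite"
  shows "bdd_above (range (\<lambda>i. \<bar>f i\<bar>))"
proof -
  have fin: "finite {i. \<not> \<bar>f i\<bar> < 1}"
    using tendstoD[OF assms, of 1] by (simp add: eventually_cofinite)
  have "range (\<lambda>i. \<bar>f i\<bar>) \<subseteq> {..1} \<union> (\<lambda>i. \<bar>f i\<bar>) ` {i. \<not> \<bar>f i\<bar> < 1}" by force
  moreover have "bdd_above ({..1} \<union> (\<lambda>i. \<bar>f i\<bar>) ` {i. \<not> \<bar>f i\<bar> < 1})"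
    using fin by (simp add: bdd_above_finite)
  ultimately show ?thesis by (rule bdd_above_mono[rotated])
qed

instantiation c0 :: (type) real_vector
begin

lift_definition zero_c0 :: "'a c0" is "\<lambda>_. 0" by simp
lift_definition plus_c0 :: "'a c0 \<Rightarrow> 'a c0 \<Rightarrow> 'a c0" is "\<lambda>f g i. f i + g i"
  by (rule tendsto_add_zero)
lift_definition minus_c0 :: "'a c0 \<Rightarrow> 'a c0 \<Rightarrow> 'a c0" is "\<lambda>f g i. f i - g i"
  using tendsto_diff by fastforce
lift_definition uminus_c0 :: "'a c0 \<Rightarrow> 'a c0" is "\<lambda>f i. - f i"
  using tendsto_minus by fastforce
lift_definition scaleR_c0 :: "real \<Rightarrow> 'a c0 \<Rightarrow> 'a c0" is "\<lambda>c f i. c * f i"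
  by (rule tendsto_mult_right_zero)

instance
  by standard (transfer; simp add: fun_eq_iff algebra_simps)+

end

instantiation c0 :: (type) real_normed_vector
begin

lift_definition norm_c0 :: "'a c0 \<Rightarrow> real" is "\<lambda>f. SUP i. \<bar>f i\<bar>" .

definition sgn_c0 :: "'a c0 \<Rightarrow> 'a c0"
  where "sgn_c0 f = inverse (norm f) *\<^sub>R f"

definition dist_c0 :: "'a c0 \<Rightarrow> 'a c0 \<Rightarrow> real"
  where "dist_c0 f g = norm (f - g)"

definition uniformity_c0 :: "('a c0 \<times> 'a c0) filter"
  where "uniformity_c0 = (INF e\<in>{0 <..}. principal {(f, g). dist f g < e})"

definition open_c0 :: "'a c0 set \<Rightarrow> bool"
  where "open_c0 U \<longleftrightarrow> (\<forall>f\<in>U. eventually (\<lambda>(f', g). f' = f \<longrightarrow> g \<in> U) uniformity)"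

lemma abs_c0_apply_le_norm: "\<bar>c0_apply f i\<bar> \<le> norm f"
  by transfer (rule cSUP_upper[OF UNIV_I c0_bounded])

lemma norm_c0_le: "(\<And>i. \<bar>c0_apply f i\<bar> \<le> c) \<Longrightarrow> norm f \<le> c"
  by transfer (rule cSUP_least, auto)

instance
proof
  fix f g :: "'a c0" and c :: real
  show "dist f g = norm (f - g)" by (rule dist_c0_def)
  show "sgn f = inverse (norm f) *\<^sub>R f" by (rule sgn_c0_def)
  show "uniformity = (INF e\<in>{0 <..}. principal {(f, g :: 'a c0). dist f g < e})"
    by (rule uniformity_c0_def)
  show "open U \<longleftrightarrow> (\<forall>f\<in>U. eventually (\<lambda>(f', g). f' = f \<longrightarrow> g \<in> U) uniformity)"
    for U :: "'a c0 set" by (rule open_c0_def)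
  have nn: "0 \<le> norm f" for f :: "'a c0"
    using abs_c0_apply_le_norm[of f undefined] by linarith
  have n0: "norm (0 :: 'a c0) = 0"
    using norm_c0_le[of "0 :: 'a c0" 0] nn[of 0] by (simp add: zero_c0.rep_eq)
  show "norm f = 0 \<longleftrightarrow> f = 0"
  proof
    assume "norm f = 0"
    then have "c0_apply f i = c0_apply 0 i" for i
      using abs_c0_apply_le_norm[of f i] by (simp add: zero_c0.rep_eq)
    then show "f = 0" by (auto simp: c0_apply_inject[symmetric] fun_eq_iff)
  qed (simp add: n0)
  show "norm (f + g) \<le> norm f + norm g"
  proof (rule norm_c0_le)
    show "\<bar>c0_apply (f + g) i\<bar> \<le> norm f + norm g" for i
      using abs_c0_apply_le_norm[of f i] abs_c0_apply_le_norm[of g i] by (simp add: plus_c0.rep_eq)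
  qed
  have le: "norm (c *\<^sub>R f) \<le> \<bar>c\<bar> * norm f" for c and f :: "'a c0"
  proof (rule norm_c0_le)
    show "\<bar>c0_apply (c *\<^sub>R f) i\<bar> \<le> \<bar>c\<bar> * norm f" for i
      using abs_c0_apply_le_norm[of f i]
      by (simp add: scaleR_c0.rep_eq abs_mult mult_left_mono)
  qed
  show "norm (c *\<^sub>R f) = \<bar>c\<bar> * norm f"
  proof (cases "c = 0")
    case False
    then have "norm f \<le> \<bar>inverse c\<bar> * norm (c *\<^sub>R f)" using le[of "inverse c" "c *\<^sub>R f"] by simp
    then have "\<bar>c\<bar> * norm f \<le> norm (c *\<^sub>R f)" using False by (simp add: field_simps)
    then show ?thesis using le[of c f] by simp
  qed (simp add: n0)
qed

end

instance c0 :: (type) banach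
proof
  fix F :: "nat \<Rightarrow> 'a c0" assume F: "Cauchy F"
  have unif: "\<exists>N. \<forall>m\<ge>N. \<forall>n\<ge>N. \<forall>i. \<bar>c0_apply (F m) i - c0_apply (F n) i\<bar> < e" if "0 < e" for e
  proof -
    obtain N where "\<forall>m\<ge>N. \<forall>n\<ge>N. dist (F m) (F n) < e" using metric_CauchyD[OF F \<open>0 < e\<close>] by blast
    moreover have "\<bar>c0_apply (F m) i - c0_apply (F n) i\<bar> \<le> dist (F m) (F n)" for m n i
      using abs_c0_apply_le_norm[of "F m - F n" i] by (simp add: minus_c0.rep_eq dist_norm)
    ultimately show ?thesis by (meson order_le_less_trans)
  qed
  define g where "g i = lim (\<lambda>n. c0_apply (F n) i)" for i
  have "Cauchy (\<lambda>n. c0_apply (F n) i)" for i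
    by (rule metric_CauchyI) (use unif in \<open>metis dist_real_def\<close>)
  then have g: "(\<lambda>n. c0_apply (F n) i) \<longlonglongrightarrow> g i" for i
    unfolding g_def using Cauchy_convergent convergent_LIMSEQ_iff by blast
  have close: "\<exists>N. \<forall>n\<ge>N. \<forall>i. \<bar>c0_apply (F n) i - g i\<bar> \<le> e" if e: "0 < e" for e
  proof -
    obtain N where N: "\<And>m n i. N \<le> m \<Longrightarrow> N \<le> n \<Longrightarrow> \<bar>c0_apply (F m) i - c0_apply (F n) i\<bar> < e"
      using unif[OF e] by blast
    have "\<bar>c0_apply (F m) i - g i\<bar> \<le> e" if m: "N \<le> m" for m i
    proof (rule LIMSEQ_le_const2)
      show "(\<lambda>n. \<bar>c0_apply (F m) i - c0_apply (F n) i\<bar>) \<longlonglongrightarrow> \<bar>c0_apply (F m) i - g i\<bar>"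
        by (intro tendsto_intros g)
      show "\<exists>N. \<forall>n\<ge>N. \<bar>c0_apply (F m) i - c0_apply (F n) i\<bar> \<le> e"
        using N[OF m] less_imp_le by blast
    qed
    then show ?thesis by blast
  qed
  have g0: "(g \<longlongrightarrow> 0) cofinite"
  proof (rule tendstoI)
    fix e :: real assume e: "0 < e"
    obtain n where n: "\<And>i. \<bar>c0_apply (F n) i - g i\<bar> \<le> e/2" using close[of "e/2"] e by auto
    have "(c0_apply (F n) \<longlongrightarrow> 0) cofinite" using c0_apply by blast
    then have "eventually (\<lambda>i. dist (c0_apply (F n) i) 0 < e/2) cofinite"
      by (rule tendstoD) (use e in simp)
    then show "eventually (\<lambda>i. dist (g i) 0 < e) cofinite"
    proof eventually_elim
      case (elim i)
      then have "\<bar>c0_apply (F n) i\<bar> < e/2" by (simp add: dist_real_def)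
      then show ?case unfolding dist_real_def using n[of i] by linarith
    qed
  qed
  have "F \<longlonglongrightarrow> Abs_c0 g"
  proof (rule metric_LIMSEQ_I)
    fix e :: real assume e: "0 < e"
    then obtain N where N: "\<And>n i. N \<le> n \<Longrightarrow> \<bar>c0_apply (F n) i - g i\<bar> \<le> e/2"
      using close[of "e/2"] by auto
    have "dist (F n) (Abs_c0 g) \<le> e/2" if "N \<le> n" for n
      unfolding dist_norm
      by (rule norm_c0_le) (use N[OF that] g0 in \<open>simp add: minus_c0.rep_eq Abs_c0_inverse\<close>)
    then show "\<exists>N. \<forall>n\<ge>N. dist (F n) (Abs_c0 g) < e" using e by (intro exI[of _ N]) fastforce
  qed
  then show "convergent F" by (auto simp: convergent_def)
qed

end

theory Submission
  imports Defs
begin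

text \<open>If \<open>z\<close> attains its norm with \<open>x\<^sub>n, y\<^sub>n\<close> and \<open>G\<close> is a bilinear form norming \<open>z\<close>, then \<open>G\<close> norms every
  pair \<open>(x\<^sub>n, y\<^sub>n)\<close>, so smoothness of the Hilbert space gives
  \<open>\<parallel>y\<^sub>n\<parallel> G(x\<^sub>n, v) = \<parallel>x\<^sub>n\<parallel> \<langle>y\<^sub>n, v\<rangle>\<close>. Dependence on finitely many coordinates near some \<open>x\<^sub>n\<close> forces
  \<open>G\<close> to have finite rank, so \<open>G(\<cdot>, v) = 0\<close> for some nonzero finite combination \<open>v\<close> of any given
  orthonormal sequence, and then the slice \<open>\<Sum> \<langle>v, y\<^sub>n\<rangle> x\<^sub>n\<close> of \<open>z\<close> is zero. A tensor
  \<open>\<Sum> e\<^sub>j \<otimes> h\<^sub>j\<close> with \<open>h\<close> orthonormal and \<open>e\<close> linearly independent has no such slice, and these tensors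
  are dense.

  Conversely, the metric \<open>\<pi>\<close>-property and orthogonal projections approximate any tensor by one in
  \<open>M \<otimes> H\<close> with \<open>M\<close>, \<open>H\<close> finite dimensional and 1-complemented. Its nearly optimal representations can
  be projected into \<open>M \<otimes> H\<close> and, by Caratheodory's theorem, shortened to a fixed length, so a
  compactness argument yields an optimal one.\<close>

subsection \<open>Bounded bilinear maps on the projective tensor product\<close>

lemma bounded_bilinear_postcompose:
  assumes T: "bounded_linear T" and B: "bounded_bilinear B"
  shows "bounded_bilinear (\<lambda>x y. T (B x y))"
proof -
  interpret T: bounded_linear T by (rule T)
  interpret B: bounded_bilinear B by (rule B)
  obtain K where K: "0 \<le> K" "\<And>z. norm (T z) \<le> norm z * K" using T.nonneg_bounded by blast
  obtain L where L: "\<And>x y. norm (B x y) \<le> norm x * norm y * L" using B.bounded by blast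
  show ?thesis
  proof
    have "norm (T (B x y)) \<le> norm x * norm y * (L * K)" for x y
      using K(2)[of "B x y"] mult_right_mono[OF L[of x y] K(1)] by (simp add: mult.assoc)
    then show "\<exists>K. \<forall>x y. norm (T (B x y)) \<le> norm x * norm y * K" by blast
  qed (simp_all add: B.add_left B.add_right B.scaleR_left B.scaleR_right T.add T.scaleR)
qed

lemma norm_atensor_le_mult: "norm (atensor x y) \<le> norm x * norm y"
  using norm_atensor_le[of "[(x, y)]"] by (simp add: atensor.abs_eq)

lemma bounded_bilinear_atensor: "bounded_bilinear atensor"
proof
  show "\<exists>K. \<forall>(a::'a) (b::'b). norm (atensor a b) \<le> norm a * norm b * K"
    by (rule exI[of _ 1]) (simp add: norm_atensor_le_mult)
qed (auto simp: bilinear_ladd bilinear_radd bilinear_lmul bilinear_rmul bilinear_atensor)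

lemma bounded_linear_to_completion: "bounded_linear to_completion"
proof (rule bounded_linear_intro[where K = 1])
  show "to_completion (x + y) = to_completion x + to_completion y" for x y :: 'a
    by transfer (simp add: cauchy_eq_refl convergent_Cauchy convergent_const)
  show "to_completion (r *\<^sub>R x) = r *\<^sub>R to_completion x" for r and x :: 'a
    by transfer (simp add: cauchy_eq_refl convergent_Cauchy convergent_const)
qed simp

lemma norm_tensor_le: "norm (x \<otimes>\<^sub>\<pi> y) \<le> norm x * norm y"
  unfolding tensor_def by (simp add: norm_atensor_le_mult)

lemma bounded_bilinear_tensor: "bounded_bilinear (\<otimes>\<^sub>\<pi>)"
  unfolding tensor_def
  by (rule bounded_bilinear_postcompose[OF bounded_linear_to_completion bounded_bilinear_atensor])

text \<open>The norm is an infimum of list costs, so some list is almost optimal. Its entries become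
  families indexed below its length, the form used by all later manipulations.\<close>

lemma atensor_representation:
  fixes u :: "('a::real_normed_vector, 'b::real_normed_vector) atensor"
  assumes "0 < e"
  obtains n :: nat and x y where "u = (\<Sum>i<n. atensor (x i) (y i))"
    and "(\<Sum>i<n. norm (x i) * norm (y i)) < norm u + e"
proof -
  obtain l where l: "abs_atensor l = u" "list_cost l < norm u + e"
    using norm_atensor_greatest[of u "norm u + e"] assms by (meson less_add_same_cancel1 linorder_not_less)
  show ?thesis
    by (rule that[of "\<lambda>i. fst (l ! i)" "\<lambda>i. snd (l ! i)" "length l"])
      (use l in \<open>simp_all add: abs_atensor_sum list_cost_def sum_list_sum_nth case_prod_beta
        atLeast0LessThan\<close>)
qed

text \<open>Extension by continuity: bounded maps preserve Cauchy sequences, so the images of any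
  approximating sequence converge in the complete target.\<close>

lemma completion_extension:
  fixes T0 :: "'a::real_normed_vector \<Rightarrow> 'b::banach"
  assumes T0: "bounded_linear T0"
  obtains T where "bounded_linear T" "\<And>x. T (to_completion x) = T0 x"
proof -
  interpret T0: bounded_linear T0 by (rule T0)
  interpret c: bounded_linear to_completion by (rule bounded_linear_to_completion)
  obtain K where K: "\<And>x. norm (T0 x) \<le> norm x * K" using T0.bounded by blast
  have "\<exists>X. Cauchy X \<and> abs_completion X = z" for z :: "'a completion"
    by (metis Quotient_abs_rep[OF Quotient_completion] Quotient_rep_reflp[OF Quotient_completion]
        cauchy_eq_def)
  then obtain X where X: "\<And>z :: 'a completion. Cauchy (X z)" "\<And>z. abs_completion (X z) = z"
    by metis
  have Xlim: "(\<lambda>n. to_completion (X z n)) \<longlonglongrightarrow> z" for z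
    using to_completion_tendsto[OF X(1)] X(2) by metis
  define T where "T z = lim (\<lambda>n. T0 (X z n))" for z
  have TX: "(\<lambda>n. T0 (X z n)) \<longlonglongrightarrow> T z" for z
    unfolding T_def using Cauchy_convergent[OF T0.Cauchy[OF X(1)]] convergent_LIMSEQ_iff by blast
  \<comment> \<open>The limit does not depend on the approximating sequence, since
    \<open>to_completion\<close> is isometric. Additivity, homogeneity and the value on the original
    space all follow by choosing suitable sequences.\<close>
  have T: "(\<lambda>n. T0 (a n)) \<longlonglongrightarrow> T z" if a: "(\<lambda>n. to_completion (a n)) \<longlonglongrightarrow> z" for a z
  proof (rule Lim_transform[OF TX])
    have "(\<lambda>n. to_completion (X z n) - to_completion (a n)) \<longlonglongrightarrow> 0"
      using tendsto_diff[OF Xlim[of z] a] by simp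
    then have "(\<lambda>n. norm (X z n - a n)) \<longlonglongrightarrow> 0"
      using tendsto_norm_zero by (fastforce simp: c.diff[symmetric])
    then have "(\<lambda>n. norm (X z n - a n) * K) \<longlonglongrightarrow> 0"
      using tendsto_mult_left_zero by blast
    then show "(\<lambda>n. T0 (a n) - T0 (X z n)) \<longlonglongrightarrow> 0"
      by (rule Lim_null_comparison[rotated])
        (auto intro!: always_eventually simp: T0.diff[symmetric] norm_minus_commute[of "X _ _"] K)
  qed
  show ?thesis
  proof (rule that)
    show "bounded_linear T"
    proof (rule bounded_linear_intro)
      fix z w r
      have "(\<lambda>n. to_completion (X z n + X w n)) \<longlonglongrightarrow> z + w"
        unfolding c.add by (intro tendsto_add Xlim)
      from T[OF this] show "T (z + w) = T z + T w"
        unfolding T0.add using tendsto_add[OF TX TX] LIMSEQ_unique by blast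
      have "(\<lambda>n. to_completion (r *\<^sub>R X z n)) \<longlonglongrightarrow> r *\<^sub>R z"
        unfolding c.scaleR by (intro tendsto_intros Xlim)
      from T[OF this] show "T (r *\<^sub>R z) = r *\<^sub>R T z"
        unfolding T0.scaleR using tendsto_scaleR[OF tendsto_const TX] LIMSEQ_unique by blast
      have "(\<lambda>n. norm (X z n)) \<longlonglongrightarrow> norm z" using tendsto_norm[OF Xlim[of z]] by simp
      from LIMSEQ_le[OF tendsto_norm[OF TX] tendsto_mult[OF this tendsto_const]]
      show "norm (T z) \<le> norm z * K" using K by blast
    qed
    show "T (to_completion x) = T0 x" for x
      using T[of "\<lambda>_. x" "to_completion x"] LIMSEQ_unique tendsto_const by blast
  qed
qed

text \<open>The algebraic linearization of \<open>h\<close> is bounded for the projective norm, as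
  almost optimal representations show, and therefore extends to the completion.\<close>

lemma tensor_universal:
  fixes h :: "'a::real_normed_vector \<Rightarrow> 'b::real_normed_vector \<Rightarrow> 'c::banach"
  assumes h: "bounded_bilinear h"
  obtains T where "bounded_linear T" "\<And>x y. T (x \<otimes>\<^sub>\<pi> y) = h x y"
proof -
  interpret h: bounded_bilinear h by (rule h)
  obtain K where K: "0 \<le> K" "\<And>x y. norm (h x y) \<le> norm x * norm y * K"
    using h.nonneg_bounded by blast
  have "bilinear h" unfolding bilinear_def
    by (auto intro!: linearI simp: h.add_left h.add_right h.scaleR_left h.scaleR_right)
  then obtain S where S: "linear S" "\<And>x y. S (atensor x y) = h x y"
    using atensor_universal[of h] by blast
  have bound: "norm (S u) \<le> norm u * K" for u
  proof (rule field_le_epsilon)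
    fix e :: real assume e: "0 < e"
    \<comment> \<open>Dividing by \<open>K + 1\<close> instead of \<open>K\<close> covers the case
      \<open>K = 0\<close>.\<close>
    then have "0 < e / (K + 1)" using K(1) by simp
    then obtain n :: nat and x y where u: "u = (\<Sum>i<n. atensor (x i) (y i))"
      "(\<Sum>i<n. norm (x i) * norm (y i)) < norm u + e / (K + 1)"
      by (rule atensor_representation)
    have "norm (S u) \<le> (\<Sum>i<n. norm (x i) * norm (y i) * K)"
      unfolding u(1) linear_sum[OF S(1)] S(2) by (intro sum_norm_le K(2))
    also have "\<dots> = (\<Sum>i<n. norm (x i) * norm (y i)) * K" by (simp add: sum_distrib_right)
    also have "\<dots> \<le> (norm u + e / (K + 1)) * K" using u(2) K(1) by (intro mult_right_mono) auto
    also have "\<dots> \<le> norm u * K + e" using e K(1) by (simp add: field_simps)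
    finally show "norm (S u) \<le> norm u * K + e" .
  qed
  have "bounded_linear S"
    by (rule bounded_linear_intro[OF linear_add[OF S(1)] linear_scale[OF S(1)] bound])
  from completion_extension[OF this] obtain T
    where "bounded_linear T" "\<And>u. T (to_completion u) = S u" by blast
  then show ?thesis using that S(2) unfolding tensor_def by metis
qed

subsection \<open>Orthonormal families\<close>

definition orthonormal_on :: "nat set \<Rightarrow> (nat \<Rightarrow> 'a::real_inner) \<Rightarrow> bool" where
  "orthonormal_on I h \<longleftrightarrow> (\<forall>i\<in>I. \<forall>j\<in>I. h i \<bullet> h j = (if i = j then 1 else 0))"

lemma orthonormal_on_subset: "orthonormal_on I h \<Longrightarrow> J \<subseteq> I \<Longrightarrow> orthonormal_on J h"
  unfolding orthonormal_on_def by blast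

lemma orthonormal_norm: "orthonormal_on I h \<Longrightarrow> i \<in> I \<Longrightarrow> norm (h i) = 1"
  unfolding orthonormal_on_def by (simp add: norm_eq_1)

lemma orthonormal_inner_sum:
  assumes "orthonormal_on I h" "finite I" "i \<in> I"
  shows "h i \<bullet> (\<Sum>j\<in>I. a j *\<^sub>R h j) = a i"
proof -
  have "h i \<bullet> (\<Sum>j\<in>I. a j *\<^sub>R h j) = (\<Sum>j\<in>I. if i = j then a j else 0)"
    unfolding inner_sum_right by (rule sum.cong) (use assms in \<open>auto simp: orthonormal_on_def\<close>)
  then show ?thesis using assms by simp
qed

text \<open>Both sides are linear in \<open>y\<close> and agree on the generators
  \<open>h k\<close>.\<close>

lemma orthonormal_expansion:
  assumes h: "orthonormal_on I h" "finite I" and y: "y \<in> span (h ` I)"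
  shows "y = (\<Sum>i\<in>I. (h i \<bullet> y) *\<^sub>R h i)"
proof -
  have "(\<lambda>y. y) y = (\<lambda>y. \<Sum>i\<in>I. (h i \<bullet> y) *\<^sub>R h i) y"
  proof (rule linear_eq_on_span[OF linear_ident _ _ y])
    show "linear (\<lambda>y. \<Sum>i\<in>I. (h i \<bullet> y) *\<^sub>R h i)"
      by (intro linear_compose_sum ballI linearI) (auto simp: inner_add_right algebra_simps)
    fix x assume "x \<in> h ` I"
    then obtain k where k: "k \<in> I" "x = h k" by blast
    have "(\<Sum>i\<in>I. (h i \<bullet> h k) *\<^sub>R h i) = (\<Sum>i\<in>I. if i = k then h k else 0)"
      by (rule sum.cong) (use h k in \<open>auto simp: orthonormal_on_def\<close>)
    then show "x = (\<Sum>i\<in>I. (h i \<bullet> x) *\<^sub>R h i)" using k h(2) by simp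
  qed
  then show ?thesis .
qed

text \<open>The projection \<open>q\<close> of \<open>y\<close> is orthogonal to
  \<open>y - q\<close>, so the square of its norm is \<open>q \<bullet> y\<close>; Cauchy-Schwarz
  then gives the bound.\<close>

lemma orthonormal_bessel:
  assumes h: "orthonormal_on I h" "finite I"
  shows "norm (\<Sum>i\<in>I. (h i \<bullet> y) *\<^sub>R h i) \<le> norm y"
proof -
  define q where "q = (\<Sum>i\<in>I. (h i \<bullet> y) *\<^sub>R h i)"
  have "h i \<bullet> (y - q) = 0" if "i \<in> I" for i
    using orthonormal_inner_sum[OF h that] unfolding q_def by (simp add: inner_diff_right)
  \<comment> \<open>The \<open>arg_cong\<close> instance unfolds only the left factor; the right one
    must keep \<open>q\<close> for the orthogonality relations to apply.\<close>
  then have "q \<bullet> (y - q) = 0" unfolding q_def[THEN arg_cong, of "\<lambda>q'. q' \<bullet> (y - q)"]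
    by (simp add: inner_sum_left)
  then have "q \<bullet> q = q \<bullet> y" by (simp add: inner_diff_right)
  then have "norm q * norm q \<le> norm q * norm y"
    using norm_cauchy_schwarz[of q y] by (simp add: dot_square_norm power2_eq_square)
  then show ?thesis unfolding q_def[symmetric]
    by (metis mult_le_cancel_left norm_ge_zero norm_zero order_le_less not_less)
qed

text \<open>One Gram-Schmidt step: subtract from \<open>v\<close> its projection and normalize the
  remainder, which is nonzero because \<open>v\<close> lies outside the span.\<close>

lemma orthonormal_new_vector:
  assumes h: "orthonormal_on I h" "finite I" and v: "v \<notin> span (h ` I)"
  obtains w where "norm w = 1" "\<And>i. i \<in> I \<Longrightarrow> h i \<bullet> w = 0" "v \<in> span (insert w (h ` I))"
proof -
  define q where "q = (\<Sum>i\<in>I. (h i \<bullet> v) *\<^sub>R h i)"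
  have q: "q \<in> span (h ` I)" unfolding q_def
    by (intro span_sum span_scale span_base) auto
  then have ne: "v - q \<noteq> 0" using v by auto
  define w where "w = (1 / norm (v - q)) *\<^sub>R (v - q)"
  have "h i \<bullet> w = 0" if "i \<in> I" for i
    using orthonormal_inner_sum[OF h that] unfolding q_def w_def by (simp add: inner_diff_right)
  moreover have "v = norm (v - q) *\<^sub>R w + q" using ne unfolding w_def by simp
  then have "v \<in> span (insert w (h ` I))"
    using q by (metis insertI1 span_add span_base span_mono span_scale subsetD subset_insertI)
  moreover have "norm w = 1" using ne unfolding w_def by simp
  ultimately show ?thesis using that by blast
qed

lemma orthonormal_on_Suc:
  assumes "orthonormal_on {..<n} h" "norm (h n) = 1" "\<And>i. i < n \<Longrightarrow> h i \<bullet> h n = 0"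
  shows "orthonormal_on {..<Suc n} h"
proof -
  have "h n \<bullet> h i = 0" if "i < n" for i using assms(3)[OF that] by (simp add: inner_commute)
  then show ?thesis
    using assms unfolding orthonormal_on_def by (auto simp: less_Suc_eq norm_eq_1)
qed

lemma orthonormal_spanning:
  fixes S :: "'a::real_inner set"
  assumes "finite S"
  obtains n h where "orthonormal_on {..<n} h" "S \<subseteq> span (h ` {..<n})"
  using assms
proof (induction S arbitrary: thesis rule: finite_induct)
  case empty
  show ?case by (rule empty[of 0]) (auto simp: orthonormal_on_def)
next
  case (insert v S)
  obtain n h where h: "orthonormal_on {..<n} h" and S: "S \<subseteq> span (h ` {..<n})"
    by (rule insert.IH)
  show ?case
  proof (cases "v \<in> span (h ` {..<n})")
    case True
    then show ?thesis using insert.prems h S by blast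
  next
    case False
    then obtain w where w: "norm w = 1" "\<And>i. i < n \<Longrightarrow> h i \<bullet> w = 0"
      "v \<in> span (insert w (h ` {..<n}))"
      using orthonormal_new_vector[OF h] by auto
    have img: "(h(n := w)) ` {..<Suc n} = insert w (h ` {..<n})"
      by (auto simp: lessThan_Suc)
    have "orthonormal_on {..<n} (h(n := w))" using h unfolding orthonormal_on_def by auto
    then have "orthonormal_on {..<Suc n} (h(n := w))"
      by (rule orthonormal_on_Suc) (use w in auto)
    moreover have "insert v S \<subseteq> span ((h(n := w)) ` {..<Suc n})"
      unfolding img using w(3) S span_mono[OF subset_insertI] by blast
    ultimately show ?thesis by (rule insert.prems)
  qed
qed

lemma infinite_dimensional_span:
  fixes S :: "'a::real_vector set"
  assumes "infinite_dimensional TYPE('a)" "finite S"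
  obtains v where "v \<notin> span S"
  using assms unfolding infinite_dimensional_def finite_dimensional_def by auto

text \<open>Gram-Schmidt continued forever by dependent choice; infinite dimension supplies a vector
  outside the span of the finitely many members already chosen.\<close>

lemma orthonormal_sequence_extending:
  fixes h :: "nat \<Rightarrow> 'a::real_inner"
  assumes inf: "infinite_dimensional TYPE('a)" and h: "orthonormal_on {..<n} h"
  obtains g where "orthonormal_on UNIV g" "\<And>i. i < n \<Longrightarrow> g i = h i"
proof -
  \<comment> \<open>\<open>P g k r\<close> says that \<open>r\<close> is an admissible member number
    \<open>k\<close> after \<open>g 0\<close>, ..., \<open>g (k - 1)\<close>: prescribed below
    \<open>n\<close>, a new orthogonal unit vector from there on.\<close>
  define P where "P g k r \<longleftrightarrow>
    (if k < n then r = h k else norm r = 1 \<and> (\<forall>i<k. g i \<bullet> r = 0))" for g k r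
  have on: "orthonormal_on {..<k} g" if "\<And>j. j < k \<Longrightarrow> P g j (g j)" for g k
    using that
  proof (induction k)
    case 0
    show ?case by (simp add: orthonormal_on_def)
  next
    case (Suc k)
    have gk: "orthonormal_on {..<k} g" using Suc by simp
    show ?case
    proof (cases "k < n")
      case True
      have "g j = h j" if "j < Suc k" for j using Suc.prems[OF that] that True unfolding P_def by simp
      then show ?thesis using h True unfolding orthonormal_on_def by simp
    next
      case False
      then show ?thesis using Suc.prems[of k] unfolding P_def by (intro orthonormal_on_Suc gk) auto
    qed
  qed
  have "\<exists>g. \<forall>k. P g k (g k)"
  proof (rule dependent_wellorder_choice)
    show "P f k r = P g k r" if "\<And>j. j < k \<Longrightarrow> f j = g j" for r f g k
      using that unfolding P_def by simp
    fix k g assume g: "\<And>j. j < k \<Longrightarrow> P g j (g j)"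
    obtain v where "v \<notin> span (g ` {..<k})"
      using infinite_dimensional_span[OF inf, of "g ` {..<k}"] by blast
    then obtain w where "norm w = 1" "\<And>i. i \<in> {..<k} \<Longrightarrow> g i \<bullet> w = 0"
      using orthonormal_new_vector[OF on[OF g], of k] by blast
    then show "\<exists>r. P g k r" unfolding P_def by auto
  qed
  then obtain g where g: "\<And>k. P g k (g k)" by blast
  have "orthonormal_on UNIV g"
    unfolding orthonormal_on_def
  proof (intro ballI)
    fix i j
    show "g i \<bullet> g j = (if i = j then 1 else 0)"
      using on[of "Suc (max i j)" g] g unfolding orthonormal_on_def by simp
  qed
  moreover have "g i = h i" if "i < n" for i using g[of i] that unfolding P_def by simp
  ultimately show ?thesis by (rule that)
qed

subsection \<open>Tensors that do not attain their norm\<close>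

text \<open>Smoothness of an inner product norm. Moving from \<open>y\<close> in an orthogonal
  direction \<open>w\<close> changes the squared norm only to second order, so a functional norming
  at \<open>y\<close> has no first order change along \<open>w\<close>.\<close>

lemma norming_functional_inner:
  fixes \<phi> :: "'b::real_inner \<Rightarrow> real"
  assumes \<phi>: "linear \<phi>" and le: "\<And>v. \<phi> v \<le> r * norm v" and y: "\<phi> y = r * norm y"
  shows "\<phi> v * norm y = r * (y \<bullet> v)"
proof (cases "y = 0")
  case False
  define c where "c = norm y"
  have c: "c > 0" "y \<bullet> y = c\<^sup>2" using False unfolding c_def by (simp_all add: dot_square_norm)
  have abs: "\<bar>\<phi> u\<bar> \<le> r * norm u" for u
    using le[of u] le[of "- u"] linear_neg[OF \<phi>, of u] by simp
  define w where "w = v - ((y \<bullet> v) / c\<^sup>2) *\<^sub>R y"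
  have yw: "y \<bullet> w = 0" unfolding w_def using c by (simp add: inner_diff_right)
  \<comment> \<open>The linear and quadratic coefficients in \<open>s\<close> when the squared bound
    at \<open>y + s *\<^sub>R w\<close> is expanded.\<close>
  define a where "a = 2 * r * c * \<phi> w"
  define b where "b = (r * norm w)\<^sup>2"
  have quad: "s * a \<le> s\<^sup>2 * b" for s
  proof -
    have "(\<phi> (y + s *\<^sub>R w))\<^sup>2 \<le> (r * norm (y + s *\<^sub>R w))\<^sup>2"
      using abs by (rule abs_le_square_iff[THEN iffD1, OF order_trans]) (simp add: abs_ge_self)
    moreover have "\<phi> (y + s *\<^sub>R w) = r * c + s * \<phi> w"
      using y by (simp add: linear_add[OF \<phi>] linear_scale[OF \<phi>] c_def)
    moreover have "(norm (y + s *\<^sub>R w))\<^sup>2 = c\<^sup>2 + s\<^sup>2 * (norm w)\<^sup>2"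
      unfolding power2_norm_eq_inner using yw c(2)
      by (simp add: inner_add_left inner_add_right inner_commute[of w y] power2_eq_square[of s])
    ultimately have "(r * c + s * \<phi> w)\<^sup>2 \<le> r\<^sup>2 * (c\<^sup>2 + s\<^sup>2 * (norm w)\<^sup>2)"
      by (simp add: power_mult_distrib)
    then have "s * a + (s * \<phi> w)\<^sup>2 \<le> s\<^sup>2 * b"
      unfolding a_def b_def by (simp add: power2_eq_square algebra_simps)
    then show ?thesis using zero_le_power2[of "s * \<phi> w"] by linarith
  qed
  have b: "0 \<le> b" unfolding b_def by simp
  have "a = 0"
  proof (rule ccontr)
    assume a: "a \<noteq> 0"
    \<comment> \<open>The choice \<open>s = a / k\<close> turns the quadratic bound into the
      impossible inequality below; adding 1 keeps \<open>k\<close> positive even if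
      \<open>b = 0\<close>.\<close>
    define k where "k = b + 1"
    have k: "k > 0" unfolding k_def using b by simp
    have "a\<^sup>2 * k = (a / k * a) * k\<^sup>2" using k by (simp add: power2_eq_square)
    also have "\<dots> \<le> ((a / k)\<^sup>2 * b) * k\<^sup>2" by (intro mult_right_mono quad) simp
    also have "\<dots> = a\<^sup>2 * b" using k by (simp add: power_divide)
    finally have "a\<^sup>2 * (b + 1) \<le> a\<^sup>2 * b" unfolding k_def .
    then show False using a by (simp add: distrib_left)
  qed
  then have "r = 0 \<or> \<phi> w = 0" using c unfolding a_def by simp
  then have "\<phi> w = 0" using abs[of w] by auto
  then have "\<phi> v = (y \<bullet> v) / c\<^sup>2 * (r * c)"
    using y unfolding w_def by (simp add: linear_diff[OF \<phi>] linear_scale[OF \<phi>] c_def)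
  then show ?thesis using c unfolding c_def[symmetric] by (simp add: field_simps power2_eq_square)
qed (use linear_0[OF \<phi>] in simp)

text \<open>Near \<open>x\<close> the norm is constant along the common kernel of the local coordinates, so by
  smoothness a bilinear form that is norming at \<open>(x, y)\<close> cannot change along that kernel.\<close>

lemma norming_form_kernel:
  fixes x :: "'a::real_normed_vector" and y :: "'b::real_inner"
  assumes lfc: "locally_finitely_many_coordinates TYPE('a)" and ne: "x \<noteq> 0" "y \<noteq> 0"
    and G: "bilinear G" and le: "\<And>x y. G x y \<le> norm x * norm y"
    and eq: "G x y = norm x * norm y"
  obtains N and f :: "nat \<Rightarrow> 'a \<Rightarrow>\<^sub>L real"
  where "\<And>w v. (\<And>i. i < N \<Longrightarrow> f i w = 0) \<Longrightarrow> G w v = 0"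
proof -
  have "\<exists>e>0. \<exists>N (f :: nat \<Rightarrow> 'a \<Rightarrow>\<^sub>L real) \<phi>.
      continuous_map (Euclidean_space N) euclideanreal \<phi> \<and>
      (\<forall>z. norm (z - x) < e \<longrightarrow> norm z = \<phi> (\<lambda>i. if i < N then f i z else 0))"
    by (rule lfc[unfolded locally_finitely_many_coordinates_def, THEN spec, THEN mp, OF ne(1)])
  then obtain e N and f :: "nat \<Rightarrow> 'a \<Rightarrow>\<^sub>L real" and \<phi> where e: "0 < e"
    and \<phi>: "\<forall>z. norm (z - x) < e \<longrightarrow> norm z = \<phi> (\<lambda>i. if i < N then f i z else 0)"
    by (elim exE conjE) (rule that)
  have "G w v = 0" if w: "\<And>i. i < N \<Longrightarrow> f i w = 0" for w v
  proof -
    \<comment> \<open>This step length keeps both \<open>x + t *\<^sub>R w\<close> and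
      \<open>x - t *\<^sub>R w\<close> in the ball where the local formula for the norm holds, also
      when \<open>w = 0\<close>.\<close>
    define t where "t = e / (2 * (norm w + 1))"
    have t: "t > 0" unfolding t_def using e by (simp add: add_nonneg_pos)
    have "t * norm w \<le> t * (norm w + 1)" using t by simp
    also have "\<dots> = e / 2" unfolding t_def by (simp add: field_simps add_nonneg_eq_0_iff)
    finally have tw: "t * norm w < e" using e by simp
    have same: "norm (x + s *\<^sub>R w) = norm x" if "\<bar>s\<bar> = t" for s
    proof -
      have "(\<lambda>i. if i < N then f i (x + s *\<^sub>R w) else 0) = (\<lambda>i. if i < N then f i x else 0)"
        using w by (auto simp: fun_eq_iff blinfun.add_right blinfun.scaleR_right)
      then show ?thesis using \<phi>[rule_format, of "x + s *\<^sub>R w"] \<phi>[rule_format, of x] that tw e by simp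
    qed
    have lin: "linear (G u)" for u using G unfolding bilinear_def by blast
    have Gs: "G (x + s *\<^sub>R w) u = G x u + s * G w u" for s u
      by (simp add: bilinear_ladd[OF G] bilinear_lmul[OF G])
    \<comment> \<open>The norm is the same at both shifted points, so \<open>G\<close> cannot exceed
      its value at \<open>(x, y)\<close> in either direction.\<close>
    have "G w y \<le> 0" "0 \<le> G w y"
      using le[of "x + t *\<^sub>R w" y] le[of "x + (- t) *\<^sub>R w" y] same[of t] same[of "- t"] eq t
      unfolding Gs by (auto simp: mult_le_0_iff zero_le_mult_iff)
    then have "G (x + t *\<^sub>R w) y = norm (x + t *\<^sub>R w) * norm y"
      unfolding Gs using same[of t] t eq by simp
    \<comment> \<open>Smoothness applies at \<open>x\<close> and at the shifted point with the same
      right-hand side; subtracting leaves \<open>t * G w v * norm y = 0\<close>.\<close>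
    then have "G (x + t *\<^sub>R w) v * norm y = norm (x + t *\<^sub>R w) * (y \<bullet> v)"
      by (rule norming_functional_inner[OF lin le])
    moreover have "G x v * norm y = norm x * (y \<bullet> v)"
      by (intro norming_functional_inner[OF lin le eq])
    ultimately show "G w v = 0" unfolding Gs using same[of t] t ne(2) by (simp add: distrib_right)
  qed
  then show ?thesis by (rule that)
qed

section \<open>Finite rank of forms with a large kernel\<close>

text \<open>Induction on \<open>N\<close>: either \<open>f N\<close> already vanishes on the common
  kernel of its predecessors, or a multiple of it can be subtracted from \<open>g\<close> to reach
  the induction hypothesis.\<close>

lemma functional_in_span:
  fixes g :: "'a::real_normed_vector \<Rightarrow>\<^sub>L real" and f :: "nat \<Rightarrow> 'a \<Rightarrow>\<^sub>L real"
  assumes "\<And>x. (\<And>i. i < N \<Longrightarrow> f i x = 0) \<Longrightarrow> g x = 0"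
  shows "g \<in> span (f ` {..<N})"
  using assms
proof (induction N arbitrary: g)
  case 0
  then have "g = 0" by (intro blinfun_eqI) simp
  then show ?case by (simp add: span_zero)
next
  case (Suc N)
  have mono: "span (f ` {..<N}) \<subseteq> span (f ` {..<Suc N})" by (intro span_mono) auto
  show ?case
  proof (cases "\<exists>u. (\<forall>i<N. f i u = 0) \<and> f N u \<noteq> 0")
    case False
    then have "g \<in> span (f ` {..<N})" by (intro Suc.IH Suc.prems) (auto simp: less_Suc_eq)
    then show ?thesis using mono by blast
  next
    case True
    then obtain u where u: "\<And>i. i < N \<Longrightarrow> f i u = 0" "f N u \<noteq> 0" by blast
    \<comment> \<open>With this \<open>c\<close> the difference \<open>g - c *\<^sub>R f N\<close>
      kills \<open>u\<close>. Every \<open>x\<close> in the kernel of the first \<open>N\<close>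
      functionals is shifted along \<open>u\<close> into the kernel of all of them.\<close>
    define c where "c = g u / f N u"
    have "g - c *\<^sub>R f N \<in> span (f ` {..<N})"
    proof (rule Suc.IH)
      fix x assume x: "\<And>i. i < N \<Longrightarrow> f i x = 0"
      have "g (x - (f N x / f N u) *\<^sub>R u) = 0"
        by (rule Suc.prems)
          (use x u in \<open>auto simp: less_Suc_eq blinfun.diff_right blinfun.scaleR_right\<close>)
      then show "(g - c *\<^sub>R f N) x = 0" unfolding c_def
        by (simp add: blinfun.diff_right blinfun.scaleR_right blinfun.diff_left blinfun.scaleR_left
            mult.commute)
    qed
    moreover have "f N \<in> span (f ` {..<Suc N})" by (rule span_base) simp
    ultimately have "(g - c *\<^sub>R f N) + c *\<^sub>R f N \<in> span (f ` {..<Suc N})"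
      using mono by (intro span_add span_scale) auto
    then show ?thesis by simp
  qed
qed

lemma orthonormal_independent:
  assumes h: "orthonormal_on I h" "finite I"
  shows "inj_on h I" "independent (h ` I)"
proof -
  show inj: "inj_on h I"
  proof (rule inj_onI, rule ccontr)
    fix i j assume "i \<in> I" "j \<in> I" "h i = h j" "i \<noteq> j"
    then show False using h(1) unfolding orthonormal_on_def by (metis zero_neq_one)
  qed
  show "independent (h ` I)"
  proof
    assume "dependent (h ` I)"
    then obtain u i where i: "i \<in> I" "u (h i) \<noteq> 0" and "(\<Sum>v\<in>h ` I. u v *\<^sub>R v) = 0"
      unfolding dependent_finite[OF finite_imageI[OF h(2)]] by auto
    then have "(\<Sum>j\<in>I. u (h j) *\<^sub>R h j) = 0" by (simp add: sum.reindex[OF inj])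
    then show False using orthonormal_inner_sum[OF h i(1), of "\<lambda>j. u (h j)"] i(2) by simp
  qed
qed

text \<open>Dimension count: the map sending \<open>v\<close> to the functional \<open>G _ v\<close>
  takes the span of the \<open>N + 1\<close> vectors \<open>h 0\<close>, ..., \<open>h N\<close>
  into the span of \<open>N\<close> functionals, so two vectors collide and their difference is the
  required \<open>v\<close>.\<close>

lemma finite_rank_form_kernel:
  fixes f :: "nat \<Rightarrow> 'a::real_normed_vector \<Rightarrow>\<^sub>L real" and h :: "nat \<Rightarrow> 'b::real_inner"
  assumes G: "bounded_bilinear G" and h: "orthonormal_on UNIV h"
    and ker: "\<And>w v. (\<And>i. i < N \<Longrightarrow> f i w = 0) \<Longrightarrow> G w v = (0::real)"
  obtains v where "v \<in> span (h ` {..N})" "v \<noteq> 0" "\<And>x. G x v = 0"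
proof -
  interpret G: bounded_bilinear G by (rule G)
  define L where "L v = Blinfun (\<lambda>x. G x v)" for v
  have L: "L v x = G x v" for v x
    unfolding L_def by (simp add: bounded_linear_Blinfun_apply G.bounded_linear_left)
  have lin: "linear L"
    by (intro linearI blinfun_eqI)
      (simp_all add: L blinfun.add_left blinfun.scaleR_left G.add_right G.scaleR_right)
  have hN: "orthonormal_on {..N} h" by (rule orthonormal_on_subset[OF h]) simp
  note ind = orthonormal_independent[OF hN finite_atMost]
  have "\<not> inj_on L (span (h ` {..N}))"
  proof
    assume inj: "inj_on L (span (h ` {..N}))"
    have "independent (L ` h ` {..N})"
      by (rule linear_independent_injective_image[OF lin ind(2) inj])
    moreover have "L ` h ` {..N} \<subseteq> span (f ` {..<N})"
      by (auto intro!: functional_in_span simp: L ker)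
    ultimately have "card (L ` h ` {..N}) \<le> card (f ` {..<N})"
      using independent_span_bound[of "f ` {..<N}"] by blast
    also have "\<dots> \<le> N" using card_image_le[of "{..<N}" f] by simp
    finally have "card (L ` h ` {..N}) \<le> N" .
    moreover have "card (L ` h ` {..N}) = Suc N"
      using card_image[OF inj_on_subset[OF inj span_superset]] card_image[OF ind(1)] by simp
    ultimately show False by simp
  qed
  then obtain a b where ab: "a \<in> span (h ` {..N})" "b \<in> span (h ` {..N})" "a \<noteq> b" "L a = L b"
    unfolding inj_on_def by blast
  show ?thesis
  proof (rule that)
    show "a - b \<in> span (h ` {..N})" using ab by (intro span_diff)
    show "a - b \<noteq> 0" using ab by simp
    show "G x (a - b) = 0" for x using ab(4) L[of a x] L[of b x] by (simp add: G.diff_right)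
  qed
qed

text \<open>A nonzero top coefficient would express \<open>e n\<close> through its predecessors;
  removing the top term, the induction continues downwards.\<close>

lemma triangular_independent:
  fixes e :: "nat \<Rightarrow> 'a::real_vector"
  assumes e: "\<And>n. e n \<notin> span (e ` {..<n})"
    and "(\<Sum>i<n. a i *\<^sub>R e i) = 0" "i < n"
  shows "a i = 0"
  using assms(2-)
proof (induction n)
  case (Suc n)
  have "a n = 0"
  proof (rule ccontr)
    assume a: "a n \<noteq> 0"
    have "(\<Sum>i<n. a i *\<^sub>R e i) \<in> span (e ` {..<n})"
      by (intro span_sum span_scale span_base) auto
    then have "(- 1 / a n) *\<^sub>R (\<Sum>i<n. a i *\<^sub>R e i) \<in> span (e ` {..<n})" by (rule span_scale)
    moreover have "(\<Sum>i<n. a i *\<^sub>R e i) = - (a n *\<^sub>R e n)"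
      using Suc.prems(1) by (simp add: eq_neg_iff_add_eq_0)
    ultimately show False using e[of n] a by simp
  qed
  then show ?case using Suc by (auto simp: less_Suc_eq)
qed simp

text \<open>The slice of a norm attaining tensor along some nonzero finite combination of the \<open>h n\<close>
  vanishes: take one that is annihilated by a norming functional.\<close>

lemma not_attaining_independent_series:
  fixes e :: "nat \<Rightarrow> 'a::banach" and h :: "nat \<Rightarrow> 'b::real_inner"
  assumes lfc: "locally_finitely_many_coordinates TYPE('a)"
    and h: "orthonormal_on UNIV h" and e: "\<And>n. e n \<notin> span (e ` {..<n})"
    and z: "(\<lambda>n. e n \<otimes>\<^sub>\<pi> h n) sums z"
  shows "z \<notin> NA"
proof
  assume "z \<in> NA"
  then obtain x y where cost: "(\<lambda>n. norm (x n) * norm (y n)) sums norm z"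
    and xy: "(\<lambda>n. x n \<otimes>\<^sub>\<pi> y n) sums z"
    unfolding NA_def attains_projective_norm_def by blast
  \<comment> \<open>\<open>T\<close> contracts the second factor against \<open>v\<close>.\<close>
  have slice: "\<exists>T. bounded_linear T \<and> (\<forall>(x::'a) y. T (x \<otimes>\<^sub>\<pi> y) = (v \<bullet> y) *\<^sub>R x)" for v :: 'b
  proof -
    have "bounded_bilinear (\<lambda>(x::'a) y. (v \<bullet> y) *\<^sub>R x)"
      by (rule bounded_bilinear.flip[OF
            bounded_bilinear.comp1[OF bounded_bilinear_scaleR bounded_linear_inner_right]])
    then show ?thesis by (rule tensor_universal) blast
  qed
  \<comment> \<open>Computed from the series of \<open>e n\<close> and \<open>h n\<close>, the slice
    is a finite combination of the \<open>e n\<close> with coefficients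
    \<open>v \<bullet> h n\<close>. If it were zero, these would all vanish and so would
    \<open>v\<close>.\<close>
  have slice_ne: "T z \<noteq> 0"
    if T: "bounded_linear T" "\<And>(x::'a) y. T (x \<otimes>\<^sub>\<pi> y) = (v \<bullet> y) *\<^sub>R x"
      and v: "v \<in> span (h ` {..N})" "v \<noteq> 0" for T v N
  proof
    assume "T z = 0"
    have hN: "orthonormal_on {..N} h" by (rule orthonormal_on_subset[OF h]) simp
    have v_eq: "v = (\<Sum>i\<le>N. (h i \<bullet> v) *\<^sub>R h i)"
      by (rule orthonormal_expansion[OF hN _ v(1)]) simp
    have "v \<bullet> h n = 0" if "N < n" for n
    proof -
      have "v \<bullet> h n = (\<Sum>i\<le>N. (h i \<bullet> v) * (h i \<bullet> h n))"
        by (subst v_eq) (simp add: inner_sum_left)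
      also have "\<dots> = 0" using h that unfolding orthonormal_on_def by (intro sum.neutral) auto
      finally show ?thesis .
    qed
    then have "(\<lambda>n. (v \<bullet> h n) *\<^sub>R e n) sums (\<Sum>n\<le>N. (v \<bullet> h n) *\<^sub>R e n)"
      by (intro sums_finite) auto
    moreover have "(\<lambda>n. (v \<bullet> h n) *\<^sub>R e n) sums T z"
      using bounded_linear.sums[OF T(1) z] by (simp add: T(2))
    ultimately have "(\<Sum>n<Suc N. (v \<bullet> h n) *\<^sub>R e n) = 0"
      using \<open>T z = 0\<close> sums_unique2 unfolding lessThan_Suc_atMost by metis
    then have "v \<bullet> h n = 0" if "n \<le> N" for n
      using triangular_independent[where e = e and n = "Suc N" and a = "\<lambda>n. v \<bullet> h n" and i = n, OF e]
        that by simp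
    then have "(\<Sum>i\<le>N. (h i \<bullet> v) *\<^sub>R h i) = 0"
      by (intro sum.neutral) (simp add: inner_commute)
    then show False using v_eq v(2) by simp
  qed
  have "z \<noteq> 0"
  proof
    assume "z = 0"
    obtain T where T: "bounded_linear T" "\<And>(x::'a) y. T (x \<otimes>\<^sub>\<pi> y) = (h 0 \<bullet> y) *\<^sub>R x"
      using slice by blast
    have "T z = 0" unfolding \<open>z = 0\<close> by (rule linear_0[OF bounded_linear.linear[OF T(1)]])
    moreover have "h 0 \<noteq> 0" using orthonormal_norm[OF h, of 0] by auto
    ultimately show False using slice_ne[OF T, of 0] by (simp add: span_base)
  qed
  obtain F :: "('a, 'b) ptensor \<Rightarrow> real"
    where F: "bounded_linear F" "\<And>u. \<bar>F u\<bar> \<le> norm u" "F z = norm z"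
    using norming_functional by blast
  define G where "G x y = F (x \<otimes>\<^sub>\<pi> y)" for x y
  have G: "bounded_bilinear G" unfolding G_def
    by (rule bounded_bilinear_postcompose[OF F(1) bounded_bilinear_tensor])
  interpret G: bounded_bilinear G by (rule G)
  have bG: "bilinear G" unfolding bilinear_def
    by (auto intro!: linearI simp: G.add_left G.add_right G.scaleR_left G.scaleR_right)
  have le: "G x y \<le> norm x * norm y" for x y
    using F(2)[of "x \<otimes>\<^sub>\<pi> y"] norm_tensor_le[of x y] unfolding G_def by linarith
  have "(\<lambda>n. G (x n) (y n)) sums norm z"
    using bounded_linear.sums[OF F(1) xy] unfolding F(3) G_def .
  from sums_diff[OF cost this]
  have d: "(\<lambda>n. norm (x n) * norm (y n) - G (x n) (y n)) sums 0" by simp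
  \<comment> \<open>The deficits are nonnegative and sum to zero, so each one is zero.\<close>
  have eq: "G (x n) (y n) = norm (x n) * norm (y n)" for n
  proof -
    have "(\<Sum>n. norm (x n) * norm (y n) - G (x n) (y n)) = 0" using sums_unique[OF d] by simp
    then have "norm (x n) * norm (y n) - G (x n) (y n) = 0"
      using suminf_eq_zero_iff[OF sums_summable[OF d]] le by simp
    then show ?thesis by simp
  qed
  have "\<exists>n. x n \<noteq> 0 \<and> y n \<noteq> 0"
  proof (rule ccontr)
    assume "\<nexists>n. x n \<noteq> 0 \<and> y n \<noteq> 0"
    then have "(\<lambda>n. norm (x n) * norm (y n)) = (\<lambda>n. 0)" by auto
    then show False using cost \<open>z \<noteq> 0\<close> sums_unique2[OF sums_zero] by fastforce
  qed
  then obtain n where n: "x n \<noteq> 0" "y n \<noteq> 0" by blast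
  obtain N and f :: "nat \<Rightarrow> 'a \<Rightarrow>\<^sub>L real"
    where "\<And>w v. (\<And>i. i < N \<Longrightarrow> f i w = 0) \<Longrightarrow> G w v = 0"
    using norming_form_kernel[OF lfc n bG le eq[of n]] by blast
  then obtain v where v: "v \<in> span (h ` {..N})" "v \<noteq> 0" and Gv: "\<And>x. G x v = 0"
    using finite_rank_form_kernel[OF G h, of N f] by blast
  obtain T where T: "bounded_linear T" "\<And>(x::'a) y. T (x \<otimes>\<^sub>\<pi> y) = (v \<bullet> y) *\<^sub>R x"
    using slice by blast
  \<comment> \<open>Although \<open>v\<close> was found from a single pair, \<open>G\<close> norms
    every pair, so \<open>G (x n) v = 0\<close> makes every term of the slice vanish.\<close>
  have zero: "(v \<bullet> y n) *\<^sub>R x n = 0" for n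
  proof -
    have "linear (G (x n))" using bG unfolding bilinear_def by blast
    from norming_functional_inner[OF this le eq[of n], of v]
    show ?thesis using Gv by (auto simp: inner_commute)
  qed
  have "(\<lambda>n. 0) sums T z" using bounded_linear.sums[OF T(1) xy] unfolding T(2) zero .
  from sums_unique2[OF sums_zero this] have "T z = 0" by simp
  then show False using slice_ne[OF T v] by blast
qed

section \<open>Approximation by independent series\<close>

text \<open>Choose the members successively: a vector that lies in the span of its predecessors
  leaves it after adding a small multiple of any vector \<open>g\<close> outside.\<close>

lemma independent_sequence_near:
  fixes x :: "nat \<Rightarrow> 'a::real_normed_vector"
  assumes inf: "infinite_dimensional TYPE('a)" and r: "\<And>n. 0 < r n"
  obtains e where "\<And>n. norm (e n - x n) < r n" "\<And>n. e n \<notin> span (e ` {..<n})"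
proof -
  have "\<exists>e. \<forall>n. norm (e n - x n) < r n \<and> e n \<notin> span (e ` {..<n})"
  proof (rule dependent_wellorder_choice)
    show "(norm (v - x n) < r n \<and> v \<notin> span (e ` {..<n})) \<longleftrightarrow>
        (norm (v - x n) < r n \<and> v \<notin> span (e' ` {..<n}))"
      if "\<And>m. m < n \<Longrightarrow> e m = e' m" for v e e' n
      using that by (metis (no_types, lifting) image_cong lessThan_iff)
    fix n and e :: "nat \<Rightarrow> 'a"
    obtain g where g: "g \<notin> span (e ` {..<n})"
      using infinite_dimensional_span[OF inf, of "e ` {..<n}"] by blast
    show "\<exists>v. norm (v - x n) < r n \<and> v \<notin> span (e ` {..<n})"
    proof (cases "x n \<in> span (e ` {..<n})")
      case False
      then show ?thesis using r by (intro exI[of _ "x n"]) simp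
    next
      case True
      have "g \<noteq> 0" using g span_zero by metis
      define t where "t = r n / (2 * norm g)"
      have t: "t \<noteq> 0" "norm (t *\<^sub>R g) < r n"
        unfolding t_def using r[of n] \<open>g \<noteq> 0\<close> by auto
      have "x n + t *\<^sub>R g \<notin> span (e ` {..<n})"
      proof
        assume "x n + t *\<^sub>R g \<in> span (e ` {..<n})"
        then have "(1 / t) *\<^sub>R ((x n + t *\<^sub>R g) - x n) \<in> span (e ` {..<n})"
          using True by (intro span_scale span_diff)
        then show False using g t by simp
      qed
      then show ?thesis using t(2) by (intro exI[of _ "x n + t *\<^sub>R g"]) simp
    qed
  qed
  then show ?thesis using that by blast
qed

lemma denseI:
  fixes S :: "'a::metric_space set"
  assumes "\<And>z e. 0 < e \<Longrightarrow> \<exists>w\<in>S. dist w z < e"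
  shows "dense S"
  unfolding dense_def using assms closure_approachable by blast

lemma ptensor_approx:
  fixes z :: "('a::real_normed_vector, 'b::real_normed_vector) ptensor"
  assumes "0 < e"
  obtains n :: nat and x y where "norm ((\<Sum>i<n. x i \<otimes>\<^sub>\<pi> y i) - z) < e"
proof -
  obtain u where u: "dist z (to_completion u) < e" using to_completion_dense[OF assms] by blast
  obtain n :: nat and x y where "u = (\<Sum>i<n. atensor (x i) (y i))"
    by (rule atensor_representation[of 1 u]) auto
  then have "to_completion u = (\<Sum>i<n. x i \<otimes>\<^sub>\<pi> y i)"
    unfolding tensor_def
    by (simp add: linear_sum[OF bounded_linear.linear[OF bounded_linear_to_completion]])
  then show ?thesis using that u by (metis dist_norm norm_minus_commute)
qed

text \<open>A finite tensor is rewritten along an orthonormal sequence, with zero coefficients at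
  the end; an arbitrarily small perturbation then makes all the coefficients independent.\<close>

lemma dense_not_NA:
  assumes lfc: "locally_finitely_many_coordinates TYPE('a::banach)"
    and inf: "infinite_dimensional TYPE('a)" "infinite_dimensional TYPE('b::real_inner)"
  shows "dense (- NA :: ('a, 'b) ptensor set)"
proof (rule denseI)
  fix z :: "('a, 'b) ptensor" and \<epsilon> :: real
  assume \<epsilon>: "0 < \<epsilon>"
  interpret t: bounded_bilinear "(\<otimes>\<^sub>\<pi>) :: 'a \<Rightarrow> 'b \<Rightarrow> _" by (rule bounded_bilinear_tensor)
  obtain n :: nat and x y where xy: "norm ((\<Sum>i<n. x i \<otimes>\<^sub>\<pi> y i) - z) < \<epsilon> / 2"
    using ptensor_approx[OF half_gt_zero[OF \<epsilon>]] by blast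
  obtain q h0 where h0: "orthonormal_on {..<q} h0" and span: "y ` {..<n} \<subseteq> span (h0 ` {..<q})"
    using orthonormal_spanning[of "y ` {..<n}"] by blast
  obtain h where h: "orthonormal_on UNIV h" "\<And>i. i < q \<Longrightarrow> h i = h0 i"
    using orthonormal_sequence_extending[OF inf(2) h0] by blast
  have hq: "orthonormal_on {..<q} h" by (rule orthonormal_on_subset[OF h(1)]) simp
  have y: "y i = (\<Sum>j<q. (h j \<bullet> y i) *\<^sub>R h j)" if "i < n" for i
  proof (rule orthonormal_expansion[OF hq])
    have "h ` {..<q} = h0 ` {..<q}" using h(2) by (intro image_cong) auto
    then show "y i \<in> span (h ` {..<q})" using span that by auto
  qed simp
  \<comment> \<open>The coefficient of \<open>h j\<close> in the finite tensor. It is zero from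
    \<open>q\<close> on, so the perturbation alone supplies the infinite tail.\<close>
  define x' where "x' j = (if j < q then \<Sum>i<n. (h j \<bullet> y i) *\<^sub>R x i else 0)" for j
  have "(\<Sum>i<n. x i \<otimes>\<^sub>\<pi> y i) = (\<Sum>i<n. \<Sum>j<q. (h j \<bullet> y i) *\<^sub>R (x i \<otimes>\<^sub>\<pi> h j))"
    by (rule sum.cong[OF refl], subst y) (auto simp: t.sum_right t.scaleR_right)
  also have "\<dots> = (\<Sum>j<q. x' j \<otimes>\<^sub>\<pi> h j)"
    unfolding x'_def by (subst sum.swap) (simp add: t.sum_left t.scaleR_left)
  finally have u: "(\<Sum>i<n. x i \<otimes>\<^sub>\<pi> y i) = (\<Sum>j<q. x' j \<otimes>\<^sub>\<pi> h j)" .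
  \<comment> \<open>Geometric radii with sum \<open>\<epsilon> / 4\<close> make the perturbing
    series absolutely convergent and leave room beside the first error
    \<open>\<epsilon> / 2\<close>.\<close>
  define r where "r j = \<epsilon> / 8 * (1 / 2) ^ j" for j :: nat
  have r: "r sums (\<epsilon> / 4)"
    unfolding r_def using sums_mult[OF geometric_sums[of "1 / 2 :: real"], of "\<epsilon> / 8"] by simp
  have "0 < r j" for j unfolding r_def using \<epsilon> by simp
  then obtain e where e: "\<And>j. norm (e j - x' j) < r j" "\<And>j. e j \<notin> span (e ` {..<j})"
    using independent_sequence_near[OF inf(1)] by blast
  have small: "norm ((e j - x' j) \<otimes>\<^sub>\<pi> h j) \<le> r j" for j
    using norm_tensor_le[of "e j - x' j" "h j"] orthonormal_norm[OF h(1), of j] e(1)[of j] by simp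
  define v where "v = (\<Sum>j. (e j - x' j) \<otimes>\<^sub>\<pi> h j)"
  have summ: "summable (\<lambda>j. norm ((e j - x' j) \<otimes>\<^sub>\<pi> h j))"
    by (rule summable_comparison_test'[OF sums_summable[OF r], of 0]) (use small in simp)
  then have v: "(\<lambda>j. (e j - x' j) \<otimes>\<^sub>\<pi> h j) sums v"
    unfolding v_def by (rule summable_sums[OF summable_norm_cancel])
  have "norm v \<le> (\<Sum>j. norm ((e j - x' j) \<otimes>\<^sub>\<pi> h j))" unfolding v_def by (rule summable_norm[OF summ])
  also have "\<dots> \<le> (\<Sum>j. r j)" by (rule suminf_le[OF small summ sums_summable[OF r]])
  also have "\<dots> = \<epsilon> / 4" using sums_unique[OF r] by simp
  finally have nv: "norm v \<le> \<epsilon> / 4" .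
  have "(\<lambda>j. x' j \<otimes>\<^sub>\<pi> h j) sums (\<Sum>j<q. x' j \<otimes>\<^sub>\<pi> h j)"
    by (rule sums_finite) (auto simp: x'_def t.zero_left)
  from sums_add[OF this v]
  have "(\<lambda>j. e j \<otimes>\<^sub>\<pi> h j) sums ((\<Sum>j<q. x' j \<otimes>\<^sub>\<pi> h j) + v)"
    by (simp add: t.diff_left)
  then have "(\<Sum>j<q. x' j \<otimes>\<^sub>\<pi> h j) + v \<notin> NA"
    by (rule not_attaining_independent_series[OF lfc h(1) e(2)])
  moreover have "dist ((\<Sum>j<q. x' j \<otimes>\<^sub>\<pi> h j) + v) z < \<epsilon>"
  proof -
    have "dist ((\<Sum>j<q. x' j \<otimes>\<^sub>\<pi> h j) + v) z = norm (((\<Sum>i<n. x i \<otimes>\<^sub>\<pi> y i) - z) + v)"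
      unfolding u dist_norm by (simp add: algebra_simps)
    also have "\<dots> \<le> norm ((\<Sum>i<n. x i \<otimes>\<^sub>\<pi> y i) - z) + norm v" by (rule norm_triangle_ineq)
    also have "\<dots> < \<epsilon>" using xy nv \<epsilon> by linarith
    finally show ?thesis .
  qed
  ultimately show "\<exists>w\<in>- NA. dist w z < \<epsilon>" by blast
qed

subsection \<open>Attainment in finite dimensions\<close>

text \<open>Dependence is needed for indexed families, where entries may repeat: two equal entries
  give coefficients 1 and -1, and otherwise the image set has too many elements to be
  independent.\<close>

lemma linear_dependence_family:
  fixes t :: "'i \<Rightarrow> 'v::real_vector"
  assumes I: "finite I" and T: "finite T" "t ` I \<subseteq> span T" "card T < card I"
  obtains a i where "i \<in> I" "a i \<noteq> 0" "(\<Sum>i\<in>I. a i *\<^sub>R t i) = 0"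
proof (cases "inj_on t I")
  case True
  have "dependent (t ` I)"
  proof (rule ccontr)
    assume "independent (t ` I)"
    then have "card (t ` I) \<le> card T" using independent_span_bound[OF T(1) _ T(2)] by blast
    then show False using T(3) card_image[OF True] by simp
  qed
  then obtain u i where "i \<in> I" "u (t i) \<noteq> 0" "(\<Sum>v\<in>t ` I. u v *\<^sub>R v) = 0"
    unfolding dependent_finite[OF finite_imageI[OF I]] by auto
  then show ?thesis using that[of i "\<lambda>i. u (t i)"] by (simp add: sum.reindex[OF True])
next
  case False
  then obtain i j where ij: "i \<in> I" "j \<in> I" "i \<noteq> j" "t i = t j" unfolding inj_on_def by blast
  have "(\<Sum>k\<in>I. ((if k = i then 1 else 0) - (if k = j then 1 else 0)) *\<^sub>R t k)
      = (\<Sum>k\<in>I. if k = i then t k else 0) - (\<Sum>k\<in>I. if k = j then t k else 0)"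
    unfolding sum_subtractf[symmetric] by (rule sum.cong) (auto simp: scaleR_diff_left)
  also have "\<dots> = 0" using I ij by simp
  finally show ?thesis
    using that[OF ij(1), of "\<lambda>k. (if k = i then 1 else 0) - (if k = j then 1 else 0)"] ij(3) by simp
qed

text \<open>Move the weights along a linear dependence that does not increase the cost until one of them
  vanishes.\<close>

lemma conic_caratheodory:
  fixes t :: "'i \<Rightarrow> 'v::real_vector" and c :: "'i \<Rightarrow> real"
  assumes "finite I" and T: "finite T" and "\<And>i. i \<in> I \<Longrightarrow> t i \<in> span T"
    and "\<And>i. i \<in> I \<Longrightarrow> 0 \<le> c i" and "\<And>i. i \<in> I \<Longrightarrow> 0 \<le> w i"
  shows "\<exists>J w'. J \<subseteq> I \<and> card J \<le> card T \<and> (\<forall>i\<in>J. 0 \<le> w' i) \<and>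
    (\<Sum>i\<in>J. w' i *\<^sub>R t i) = (\<Sum>i\<in>I. w i *\<^sub>R t i) \<and>
    (\<Sum>i\<in>J. w' i * c i) \<le> (\<Sum>i\<in>I. w i * c i)"
  using assms(1,3-)
proof (induction "card I" arbitrary: I w rule: less_induct)
  case less
  note I = less.prems(1) and t = less.prems(2) and c = less.prems(3) and w = less.prems(4)
  show ?case
  proof (cases "card I \<le> card T")
    case True
    then show ?thesis using w by (intro exI[of _ I] exI[of _ w]) simp
  next
    case False
    then obtain b k where b: "k \<in> I" "b k \<noteq> 0" "(\<Sum>i\<in>I. b i *\<^sub>R t i) = 0"
      using linear_dependence_family[OF I T, of t] t by (metis image_subsetI not_less)
    have "\<exists>a. (\<exists>i\<in>I. 0 < a i) \<and> (\<Sum>i\<in>I. a i *\<^sub>R t i) = 0 \<and> 0 \<le> (\<Sum>i\<in>I. a i * c i)"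
    proof (cases "(\<exists>i\<in>I. 0 < b i) \<and> 0 \<le> (\<Sum>i\<in>I. b i * c i)")
      case True
      then show ?thesis using b(3) by blast
    next
      case False
      \<comment> \<open>Without a negative entry, \<open>b k\<close> would be positive and the cost
        change nonnegative, contrary to the case assumption. Hence \<open>- b\<close> has a positive
        entry and can serve as \<open>a\<close>.\<close>
      have neg: "\<exists>i\<in>I. b i < 0"
      proof (rule ccontr)
        assume "\<not> (\<exists>i\<in>I. b i < 0)"
        then have "\<And>i. i \<in> I \<Longrightarrow> 0 \<le> b i" by force
        moreover from this have "0 < b k" using b by fastforce
        ultimately show False using False b(1) c by (auto intro!: sum_nonneg)
      qed
      have "(\<Sum>i\<in>I. b i * c i) \<le> 0"
      proof (cases "\<exists>i\<in>I. 0 < b i")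
        case True
        then show ?thesis using False by simp
      next
        case False
        then show ?thesis using c by (intro sum_nonpos mult_nonpos_nonneg) auto
      qed
      then show ?thesis using neg b(3)
        by (intro exI[of _ "\<lambda>i. - b i"]) (auto simp: sum_negf)
    qed
    then obtain a where a: "\<exists>i\<in>I. 0 < a i" "(\<Sum>i\<in>I. a i *\<^sub>R t i) = 0"
      "0 \<le> (\<Sum>i\<in>I. a i * c i)" by blast
    define P where "P = {i \<in> I. 0 < a i}"
    have P: "finite P" "P \<noteq> {}" unfolding P_def using I a(1) by auto
    \<comment> \<open>The smallest ratio is the longest step along \<open>- a\<close> that keeps all
      weights nonnegative; the weight at \<open>k\<close> then becomes zero.\<close>
    define k where "k = arg_min_on (\<lambda>i. w i / a i) P"
    have k: "k \<in> P" "\<And>i. i \<in> P \<Longrightarrow> w k / a k \<le> w i / a i"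
      using arg_min_if_finite[OF P, of "\<lambda>i. w i / a i"] unfolding k_def by (auto simp: not_less)
    have kI: "k \<in> I" and ak: "0 < a k" using k(1) unfolding P_def by auto
    define \<theta> where "\<theta> = w k / a k"
    have \<theta>: "0 \<le> \<theta>" unfolding \<theta>_def using w kI ak by simp
    define w' where "w' i = w i - \<theta> * a i" for i
    have w'k: "w' k = 0" unfolding w'_def \<theta>_def using ak by simp
    have w'0: "0 \<le> w' i" if i: "i \<in> I" for i
    proof (cases "0 < a i")
      case True
      then have "\<theta> \<le> w i / a i" using k(2)[of i] i unfolding P_def \<theta>_def by simp
      then show ?thesis unfolding w'_def using True by (simp add: field_simps)
    next
      case False
      then have "\<theta> * a i \<le> 0" using \<theta> by (simp add: mult_nonneg_nonpos)
      then show ?thesis unfolding w'_def using w[OF i] by simp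
    qed
    have "(\<Sum>i\<in>I - {k}. w' i *\<^sub>R t i) = (\<Sum>i\<in>I. w' i *\<^sub>R t i)"
      using sum.remove[OF I kI, of "\<lambda>i. w' i *\<^sub>R t i"] w'k by simp
    also have "\<dots> = (\<Sum>i\<in>I. w i *\<^sub>R t i) - \<theta> *\<^sub>R (\<Sum>i\<in>I. a i *\<^sub>R t i)"
      unfolding w'_def by (simp add: scaleR_diff_left sum_subtractf scaleR_sum_right)
    finally have tensor: "(\<Sum>i\<in>I - {k}. w' i *\<^sub>R t i) = (\<Sum>i\<in>I. w i *\<^sub>R t i)" using a(2) by simp
    have "(\<Sum>i\<in>I - {k}. w' i * c i) = (\<Sum>i\<in>I. w' i * c i)"
      using sum.remove[OF I kI, of "\<lambda>i. w' i * c i"] w'k by simp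
    also have "\<dots> = (\<Sum>i\<in>I. w i * c i) - \<theta> * (\<Sum>i\<in>I. a i * c i)"
      unfolding w'_def by (simp add: left_diff_distrib sum_subtractf sum_distrib_left mult.assoc)
    also have "\<dots> \<le> (\<Sum>i\<in>I. w i * c i)" using \<theta> a(3) by simp
    finally have cost: "(\<Sum>i\<in>I - {k}. w' i * c i) \<le> (\<Sum>i\<in>I. w i * c i)" .
    have "\<exists>J v. J \<subseteq> I - {k} \<and> card J \<le> card T \<and> (\<forall>i\<in>J. 0 \<le> v i) \<and>
        (\<Sum>i\<in>J. v i *\<^sub>R t i) = (\<Sum>i\<in>I - {k}. w' i *\<^sub>R t i) \<and>
        (\<Sum>i\<in>J. v i * c i) \<le> (\<Sum>i\<in>I - {k}. w' i * c i)"
      by (rule less.hyps[OF card_Diff1_less[OF I kI]]) (use I t c w'0 in auto)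
    then show ?thesis unfolding tensor using cost by fastforce
  qed
qed

section \<open>Compactness of the short representations\<close>

lemma compact_sumset:
  fixes C :: "nat \<Rightarrow> 'a::real_normed_vector set"
  assumes "\<And>i. i < n \<Longrightarrow> compact (C i)"
  shows "compact {\<Sum>i<n. p i | p. \<forall>i<n. p i \<in> C i}"
  using assms
proof (induction n)
  case (Suc n)
  let ?S = "\<lambda>n. {\<Sum>i<n. p i | p. \<forall>i<n. p i \<in> C i}"
  have "?S (Suc n) = {x + y | x y. x \<in> ?S n \<and> y \<in> C n}"
  proof (intro equalityI subsetI)
    fix v assume "v \<in> {x + y | x y. x \<in> ?S n \<and> y \<in> C n}"
    then obtain p y where p: "v = (\<Sum>i<n. p i) + y" "\<forall>i<n. p i \<in> C i" "y \<in> C n" by blast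
    have "(\<Sum>i<n. (p(n := y)) i) = (\<Sum>i<n. p i)" by (rule sum.cong) auto
    then show "v \<in> ?S (Suc n)"
      using p by (intro CollectI exI[of _ "p(n := y)"]) (auto simp: less_Suc_eq)
  qed (force simp: less_Suc_eq)
  moreover have "compact (?S n)" using Suc by simp
  ultimately show ?case using compact_sums[of "?S n" "C n"] Suc.prems by simp
qed simp

text \<open>Bounded coordinate functionals confine the points of the ball to a sum of finitely many
  compact segments.\<close>

lemma bounded_span_subset_compact:
  fixes B :: "'a::real_normed_vector set"
  assumes "finite B"
  obtains K where "compact K" "span B \<inter> cball 0 r \<subseteq> K"
proof -
  obtain n :: nat and \<phi> and e :: "nat \<Rightarrow> 'a" where \<phi>: "\<And>i. bounded_linear (\<phi> i)"
    and B: "\<And>x. x \<in> B \<Longrightarrow> x = (\<Sum>i<n. \<phi> i x *\<^sub>R e i)"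
    using finite_coordinates[OF assms] by metis
  have expand: "x = (\<Sum>i<n. \<phi> i x *\<^sub>R e i)" if "x \<in> span B" for x
  proof -
    have "(\<lambda>x. x) x = (\<lambda>x. \<Sum>i<n. \<phi> i x *\<^sub>R e i) x"
    proof (rule linear_eq_on_span[OF linear_ident _ _ that])
      show "linear (\<lambda>x. \<Sum>i<n. \<phi> i x *\<^sub>R e i)"
        by (intro bounded_linear.linear bounded_linear_sum
            bounded_linear_compose[OF bounded_linear_scaleR_left \<phi>])
    qed (use B in auto)
    then show ?thesis .
  qed
  have "\<exists>k\<ge>0. \<forall>x. norm (\<phi> i x) \<le> norm x * k" for i
    using bounded_linear.nonneg_bounded[OF \<phi>[of i]] by blast
  then obtain k where k: "\<And>i. 0 \<le> k i" "\<And>i x. norm (\<phi> i x) \<le> norm x * k i" by metis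
  define C where "C i = (\<lambda>a. a *\<^sub>R e i) ` {- (r * k i)..r * k i}" for i
  show ?thesis
  proof (rule that)
    show "compact {\<Sum>i<n. p i | p. \<forall>i<n. p i \<in> C i}"
      unfolding C_def by (intro compact_sumset compact_continuous_image continuous_intros) auto
    show "span B \<inter> cball 0 r \<subseteq> {\<Sum>i<n. p i | p. \<forall>i<n. p i \<in> C i}"
    proof
      fix x assume x: "x \<in> span B \<inter> cball 0 r"
      have "\<bar>\<phi> i x\<bar> \<le> r * k i" for i
        using k(2)[of i x] mult_right_mono[of "norm x" r "k i"] k(1)[of i] x by simp
      then have "\<phi> i x *\<^sub>R e i \<in> C i" for i
        unfolding C_def by (intro imageI) (simp add: abs_le_iff minus_le_iff)
      then show "x \<in> {\<Sum>i<n. p i | p. \<forall>i<n. p i \<in> C i}"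
        using expand[of x] x by (intro CollectI exI[of _ "\<lambda>i. \<phi> i x *\<^sub>R e i"]) simp
    qed
  qed
qed

lemma atensor_in_span:
  assumes x: "x \<in> span B" and y: "y \<in> span D"
  shows "atensor x y \<in> span ((\<lambda>(b, d). atensor b d) ` (B \<times> D))" (is "_ \<in> span ?T")
proof -
  have b: "atensor b y \<in> span ?T" if "b \<in> B" for b
  proof (rule span_induct[OF y])
    show "subspace {y. atensor b y \<in> span ?T}"
      by (auto simp: subspace_def bilinear_radd[OF bilinear_atensor] bilinear_rmul[OF bilinear_atensor]
          bilinear_rzero[OF bilinear_atensor] span_zero span_add span_scale)
    show "atensor b d \<in> span ?T" if "d \<in> D" for d
      using that \<open>b \<in> B\<close> by (intro span_base) auto
  qed
  show ?thesis
  proof (rule span_induct[OF x])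
    show "subspace {x. atensor x y \<in> span ?T}"
      by (auto simp: subspace_def bilinear_ladd[OF bilinear_atensor] bilinear_lmul[OF bilinear_atensor]
          bilinear_lzero[OF bilinear_atensor] span_zero span_add span_scale)
  qed (rule b)
qed

text \<open>Only products of norms are controlled by the cost. Shifting the weight and the norm of
  \<open>y\<close> to the first factor bounds each factor separately; for \<open>y = 0\<close> the
  convention \<open>inverse 0 = 0\<close> makes both new vectors zero.\<close>

lemma atensor_normalize:
  assumes "0 \<le> w"
  obtains x' y' where "w *\<^sub>R atensor x y = atensor x' y'" "w * (norm x * norm y) = norm x' * norm y'"
    "norm x' = w * (norm x * norm y)" "norm y' \<le> 1" "x' \<in> span {x}" "y' \<in> span {y}"
proof (rule that)
  let ?x = "(w * norm y) *\<^sub>R x" and ?y = "inverse (norm y) *\<^sub>R y"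
  show "w *\<^sub>R atensor x y = atensor ?x ?y"
    by (cases "y = 0") (auto simp: bilinear_lmul[OF bilinear_atensor] bilinear_rmul[OF bilinear_atensor]
        bilinear_rzero[OF bilinear_atensor])
  show "norm ?x = w * (norm x * norm y)" using assms by simp
  show "w * (norm x * norm y) = norm ?x * norm ?y" "norm ?y \<le> 1"
    using assms by (cases "y = 0"; simp)+
qed (auto intro: span_scale span_base)

text \<open>With length \<open>card T\<close> and normalized factors, the pairs of tensor and cost
  range over a closed set \<open>S\<close>. It contains \<open>(u, c k)\<close> with
  \<open>c k\<close> tending to \<open>norm u\<close>, hence also
  \<open>(u, norm u)\<close>.\<close>

lemma finite_dimensional_attainment:
  fixes u :: "('a::real_normed_vector, 'b::real_normed_vector) atensor"
  assumes B: "finite B" and D: "finite D"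
    and rep: "\<And>e. 0 < e \<Longrightarrow> \<exists>(n::nat) x y. u = (\<Sum>i<n. atensor (x i) (y i)) \<and>
      (\<forall>i<n. x i \<in> span B \<and> y i \<in> span D) \<and> (\<Sum>i<n. norm (x i) * norm (y i)) < norm u + e"
  obtains n :: nat and x y
    where "u = (\<Sum>i<n. atensor (x i) (y i))" "(\<Sum>i<n. norm (x i) * norm (y i)) = norm u"
proof -
  define T where "T = (\<lambda>(b, d). atensor b d) ` (B \<times> D)"
  have T: "finite T" unfolding T_def using B D by simp
  obtain K1 where K1: "compact K1" "span B \<inter> cball 0 (norm u + 1) \<subseteq> K1"
    by (rule bounded_span_subset_compact[OF B])
  obtain K2 where K2: "compact K2" "span D \<inter> cball 0 1 \<subseteq> K2"
    by (rule bounded_span_subset_compact[OF D])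
  \<comment> \<open>Recording tensor and cost together ensures that a limit point comes from one
    representation having both values.\<close>
  define F where "F = (\<lambda>(x::'a, y::'b). (atensor x y, norm x * norm y))"
  define C where "C = F ` (K1 \<times> K2)"
  have "compact C" unfolding C_def F_def case_prod_beta
    by (intro compact_continuous_image compact_Times K1(1) K2(1) continuous_intros
        bounded_bilinear.continuous_on[OF bounded_bilinear_atensor])
  define S where "S = {\<Sum>i<card T. p i | p. \<forall>i<card T. p i \<in> C}"
  have S: "closed S" unfolding S_def
    by (intro compact_imp_closed compact_sumset \<open>compact C\<close>)
  have "0 \<in> K1" "0 \<in> K2" using K1(2) K2(2) by (auto simp: span_zero)
  then have "F (0, 0) \<in> C" unfolding C_def by blast
  then have C0: "0 \<in> C"
    unfolding F_def by (simp add: bilinear_lzero[OF bilinear_atensor] zero_prod_def)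
  have near: "\<exists>c. (u, c) \<in> S \<and> c < norm u + e" if e: "0 < e" "e \<le> 1" for e
  proof -
    obtain n :: nat and x y where u: "u = (\<Sum>i<n. atensor (x i) (y i))"
      and xy: "\<And>i. i < n \<Longrightarrow> x i \<in> span B \<and> y i \<in> span D"
      and cost: "(\<Sum>i<n. norm (x i) * norm (y i)) < norm u + e"
      using rep[OF e(1)] by blast
    have T_in: "atensor (x i) (y i) \<in> span T" if "i \<in> {..<n}" for i
      unfolding T_def using atensor_in_span xy that by blast
    have "\<exists>J w. J \<subseteq> {..<n} \<and> card J \<le> card T \<and> (\<forall>i\<in>J. 0 \<le> w i) \<and>
        (\<Sum>i\<in>J. w i *\<^sub>R atensor (x i) (y i)) = (\<Sum>i<n. 1 *\<^sub>R atensor (x i) (y i)) \<and>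
        (\<Sum>i\<in>J. w i * (norm (x i) * norm (y i))) \<le> (\<Sum>i<n. 1 * (norm (x i) * norm (y i)))"
      by (rule conic_caratheodory[OF _ T T_in]) auto
    then obtain J w where J: "J \<subseteq> {..<n}" "card J \<le> card T" and w: "\<And>i. i \<in> J \<Longrightarrow> 0 \<le> w i"
      and Ju: "(\<Sum>i\<in>J. w i *\<^sub>R atensor (x i) (y i)) = u"
      and Jc: "(\<Sum>i\<in>J. w i * (norm (x i) * norm (y i))) \<le> (\<Sum>i<n. norm (x i) * norm (y i))"
      unfolding scaleR_one mult_1 u[symmetric] by blast
    have fJ: "finite J" using J(1) finite_subset by blast
    define p where "p i = (w i *\<^sub>R atensor (x i) (y i), w i * (norm (x i) * norm (y i)))" for i
    have pC: "p i \<in> C" if i: "i \<in> J" for i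
    proof -
      obtain x' y' where *: "w i *\<^sub>R atensor (x i) (y i) = atensor x' y'"
        "w i * (norm (x i) * norm (y i)) = norm x' * norm y'"
        "norm x' = w i * (norm (x i) * norm (y i))" "norm y' \<le> 1" "x' \<in> span {x i}" "y' \<in> span {y i}"
        by (rule atensor_normalize[OF w[OF i]])
      have "norm x' \<le> (\<Sum>i\<in>J. w i * (norm (x i) * norm (y i)))"
        unfolding *(3) by (rule member_le_sum[OF i _ fJ]) (use w in auto)
      then have "norm x' \<le> norm u + 1" using Jc cost e by linarith
      moreover have "x' \<in> span B" "y' \<in> span D"
        using *(5,6) xy[of i] i J(1) span_minimal[of "{x i}" "span B"] span_minimal[of "{y i}" "span D"]
        by (auto simp: subspace_span)
      ultimately have "(x', y') \<in> K1 \<times> K2" using K1(2) K2(2) *(4) by auto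
      then show ?thesis unfolding C_def p_def F_def *(1,2) by force
    qed
    obtain g where g: "bij_betw g {..<card J} J"
      using ex_bij_betw_nat_finite[OF fJ] unfolding atLeast0LessThan by blast
    \<comment> \<open>Caratheodory gives at most \<open>card T\<close> terms; zeros, which lie in
      \<open>C\<close>, bring the length to exactly \<open>card T\<close>.\<close>
    define q where "q i = (if i < card J then p (g i) else 0)" for i
    have "q i \<in> C" for i
      unfolding q_def using pC C0 bij_betwE[OF g] by auto
    then have "(\<Sum>i<card T. q i) \<in> S" unfolding S_def by blast
    also have "(\<Sum>i<card T. q i) = (\<Sum>i<card J. p (g i))"
      by (rule sum.mono_neutral_cong_right) (use J(2) in \<open>auto simp: q_def\<close>)
    also have "\<dots> = (\<Sum>i\<in>J. p i)" by (rule sum.reindex_bij_betw[OF g])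
    also have "\<dots> = (u, \<Sum>i\<in>J. w i * (norm (x i) * norm (y i)))"
      unfolding p_def by (rule prod_eqI) (simp_all add: fst_sum snd_sum Ju)
    finally show ?thesis using Jc cost by (intro exI) auto
  qed
  have S_split: "\<exists>x y. fst s = (\<Sum>i<card T. atensor (x i) (y i)) \<and>
      snd s = (\<Sum>i<card T. norm (x i) * norm (y i))" if s: "s \<in> S" for s
  proof -
    obtain p where p: "s = (\<Sum>i<card T. p i)" "\<forall>i<card T. p i \<in> C" using s unfolding S_def by blast
    have "\<exists>x y. v = (atensor x y, norm x * norm y)" if "v \<in> C" for v
      using that unfolding C_def F_def by auto
    then have "\<forall>i<card T. \<exists>x y. p i = (atensor x y, norm x * norm y)" using p(2) by blast
    then obtain x y where "\<forall>i<card T. p i = (atensor (x i) (y i), norm (x i) * norm (y i))" by metis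
    then show ?thesis unfolding p(1) by (intro exI[of _ x] exI[of _ y]) (simp add: fst_sum snd_sum)
  qed
  have "\<forall>k::nat. \<exists>c. (u, c) \<in> S \<and> c < norm u + inverse (real (Suc k))"
    by (intro allI near) (simp_all add: field_simps)
  then obtain c where c: "\<And>k::nat. (u, c k) \<in> S" "\<And>k. c k < norm u + inverse (real (Suc k))" by metis
  have lower: "norm u \<le> c k" for k
  proof -
    obtain x y where "u = (\<Sum>i<card T. atensor (x i) (y i))"
      "c k = (\<Sum>i<card T. norm (x i) * norm (y i))" using S_split[OF c(1)[of k]] by auto
    then show ?thesis by (auto intro!: sum_norm_le norm_atensor_le_mult)
  qed
  have upper: "(\<lambda>k. norm u + inverse (real (Suc k))) \<longlonglongrightarrow> norm u"
    using LIMSEQ_inverse_real_of_nat_add by blast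
  have "c \<longlonglongrightarrow> norm u"
    by (rule tendsto_sandwich[OF _ _ tendsto_const upper])
      (use lower c(2) in \<open>auto intro!: always_eventually less_imp_le\<close>)
  then have "(\<lambda>k. (u, c k)) \<longlonglongrightarrow> (u, norm u)" by (intro tendsto_intros)
  then have "(u, norm u) \<in> S" by (rule closed_sequentially[OF S c(1)])
  from S_split[OF this] obtain x y where "u = (\<Sum>i<card T. atensor (x i) (y i))"
    "norm u = (\<Sum>i<card T. norm (x i) * norm (y i))" by auto
  then show ?thesis using that by metis
qed

subsection \<open>Density of the norm attaining tensors\<close>

lemma attains_finite_sum:
  fixes u :: "('a::real_normed_vector, 'b::real_normed_vector) atensor" and n :: nat
  assumes u: "u = (\<Sum>i<n. atensor (x i) (y i))" and cost: "(\<Sum>i<n. norm (x i) * norm (y i)) = norm u"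
  shows "to_completion u \<in> NA"
proof -
  define x' where "x' i = (if i < n then x i else 0)" for i
  interpret t: bounded_bilinear "(\<otimes>\<^sub>\<pi>) :: 'a \<Rightarrow> 'b \<Rightarrow> _" by (rule bounded_bilinear_tensor)
  have "(\<lambda>i. norm (x' i) * norm (y i)) sums (\<Sum>i<n. norm (x' i) * norm (y i))"
    by (rule sums_finite) (auto simp: x'_def)
  then have "(\<lambda>i. norm (x' i) * norm (y i)) sums norm (to_completion u)"
    using cost by (simp add: x'_def)
  moreover have "(\<lambda>i. x' i \<otimes>\<^sub>\<pi> y i) sums (\<Sum>i<n. x' i \<otimes>\<^sub>\<pi> y i)"
    by (rule sums_finite) (auto simp: x'_def t.zero_left)
  then have "(\<lambda>i. x' i \<otimes>\<^sub>\<pi> y i) sums to_completion u"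
    unfolding u linear_sum[OF bounded_linear.linear[OF bounded_linear_to_completion]]
    by (simp add: x'_def tensor_def)
  ultimately show ?thesis unfolding NA_def attains_projective_norm_def by blast
qed

text \<open>The map induced by \<open>P\<close> and \<open>Q\<close> fixes the tensor, does not
  raise the cost of a representation and sends its vectors into \<open>span B\<close> and
  \<open>span D\<close>. So almost optimal representations exist inside the finite-dimensional
  spaces.\<close>

lemma attains_complemented:
  fixes P :: "'a::real_normed_vector \<Rightarrow> 'a" and Q :: "'b::real_normed_vector \<Rightarrow> 'b"
    and n :: nat
  assumes P: "linear P" "\<And>x. norm (P x) \<le> norm x" "range P \<subseteq> span B" "finite B"
    and Q: "linear Q" "\<And>y. norm (Q y) \<le> norm y" "range Q \<subseteq> span D" "finite D"
    and fixed: "\<And>i. i < n \<Longrightarrow> P (x i) = x i" "\<And>i. i < n \<Longrightarrow> Q (y i) = y i"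
  shows "(\<Sum>i<n. x i \<otimes>\<^sub>\<pi> y i) \<in> NA"
proof -
  define u where "u = (\<Sum>i<n. atensor (x i) (y i))"
  have "bilinear (\<lambda>x y. atensor (P x) (Q y))"
    unfolding bilinear_def
    by (auto intro!: linearI simp: linear_add[OF P(1)] linear_add[OF Q(1)] linear_scale[OF P(1)]
        linear_scale[OF Q(1)] bilinear_ladd[OF bilinear_atensor] bilinear_radd[OF bilinear_atensor]
        bilinear_lmul[OF bilinear_atensor] bilinear_rmul[OF bilinear_atensor])
  then obtain S where S: "linear S" "\<And>x y. S (atensor x y) = atensor (P x) (Q y)"
    using atensor_universal[of "\<lambda>x y. atensor (P x) (Q y)"] by blast
  have Su: "S u = u" unfolding u_def linear_sum[OF S(1)] S(2) using fixed by simp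
  obtain m :: nat and x' y'
    where "u = (\<Sum>i<m. atensor (x' i) (y' i))" "(\<Sum>i<m. norm (x' i) * norm (y' i)) = norm u"
  proof (rule finite_dimensional_attainment[OF P(4) Q(4), of u])
    fix e :: real assume "0 < e"
    then obtain m :: nat and a b where ab: "u = (\<Sum>i<m. atensor (a i) (b i))"
      "(\<Sum>i<m. norm (a i) * norm (b i)) < norm u + e" by (rule atensor_representation)
    have "u = (\<Sum>i<m. atensor (P (a i)) (Q (b i)))"
      using Su ab(1) by (metis (no_types, lifting) S linear_sum sum.cong)
    moreover have "(\<Sum>i<m. norm (P (a i)) * norm (Q (b i))) \<le> (\<Sum>i<m. norm (a i) * norm (b i))"
      by (intro sum_mono mult_mono P(2) Q(2)) auto
    ultimately show "\<exists>(m::nat) x y. u = (\<Sum>i<m. atensor (x i) (y i)) \<and>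
        (\<forall>i<m. x i \<in> span B \<and> y i \<in> span D) \<and> (\<Sum>i<m. norm (x i) * norm (y i)) < norm u + e"
      using P(3) Q(3) ab(2)
      by (intro exI[of _ m] exI[of _ "\<lambda>i. P (a i)"] exI[of _ "\<lambda>i. Q (b i)"]) auto
  qed
  then have "to_completion u \<in> NA" by (rule attains_finite_sum)
  then show ?thesis
    unfolding u_def linear_sum[OF bounded_linear.linear[OF bounded_linear_to_completion]]
    by (simp add: tensor_def)
qed

text \<open>The property concerns unit vectors, so the \<open>x i\<close> are normalized first and
  the approximants scaled back, which makes the error relative to \<open>norm (x i)\<close>.\<close>

lemma metric_pi_approx:
  fixes x :: "nat \<Rightarrow> 'a::real_normed_vector"
  assumes pi: "metric_pi_property TYPE('a)" and \<delta>: "0 < \<delta>"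
  obtains P :: "'a \<Rightarrow>\<^sub>L 'a" and B m where "finite B" "range P = span B" "norm P \<le> 1"
    "\<And>i. P (m i) = m i" "\<And>i. i < n \<Longrightarrow> norm (x i - m i) \<le> norm (x i) * \<delta>"
proof -
  define F where "F = (\<lambda>i. inverse (norm (x i)) *\<^sub>R x i) ` {i. i < n \<and> x i \<noteq> 0}"
  have "finite F" "F \<subseteq> sphere 0 1" unfolding F_def by auto
  then obtain M where M: "finite_dimensional M" "one_complemented M"
    "\<forall>v\<in>F. \<exists>v'\<in>M. norm (v - v') < \<delta>"
    using pi \<delta> unfolding metric_pi_property_def by meson
  obtain B where B: "finite B" "M = span B" using M(1) unfolding finite_dimensional_def by blast
  obtain P :: "'a \<Rightarrow>\<^sub>L 'a" where P: "P o\<^sub>L P = P" "norm P \<le> 1" "range P = M"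
    using M(2) unfolding one_complemented_def by blast
  have fixed: "P v = v" if "v \<in> M" for v
    using that P(1) unfolding P(3)[symmetric] by (metis blinfun_apply_blinfun_compose imageE)
  \<comment> \<open>The disjunct \<open>\<not> i < n\<close> lets \<open>m\<close> be chosen in
    \<open>M\<close> for every index.\<close>
  have "\<exists>m\<in>M. norm (x i - m) \<le> norm (x i) * \<delta> \<or> \<not> i < n" for i
  proof (cases "i < n \<and> x i \<noteq> 0")
    case True
    then obtain v where v: "v \<in> M" "norm (inverse (norm (x i)) *\<^sub>R x i - v) < \<delta>"
      using M(3) unfolding F_def by blast
    have "x i - norm (x i) *\<^sub>R v = norm (x i) *\<^sub>R (inverse (norm (x i)) *\<^sub>R x i - v)"
      using True by (simp add: scaleR_diff_right)
    then have "norm (x i - norm (x i) *\<^sub>R v) = norm (x i) * norm (inverse (norm (x i)) *\<^sub>R x i - v)"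
      by (metis norm_scaleR abs_norm_cancel)
    also have "\<dots> \<le> norm (x i) * \<delta>" using v(2) by (intro mult_left_mono) auto
    finally have "norm (x i - norm (x i) *\<^sub>R v) \<le> norm (x i) * \<delta>" .
    moreover have "norm (x i) *\<^sub>R v \<in> M" using v(1) unfolding B(2) by (rule span_scale)
    ultimately show ?thesis by blast
  next
    case False
    moreover have "0 \<in> M" unfolding B(2) by (rule span_zero)
    ultimately show ?thesis by force
  qed
  then obtain m where "\<And>i. m i \<in> M" "\<And>i. i < n \<Longrightarrow> norm (x i - m i) \<le> norm (x i) * \<delta>" by metis
  then show ?thesis using that[of B P m] B P fixed by blast
qed

text \<open>The orthogonal projection \<open>Q\<close> fixes every \<open>y i\<close> exactly, so
  only the first factors are moved, at a total cost of at most \<open>s * \<delta>\<close>.\<close>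

lemma dense_NA:
  assumes pi: "metric_pi_property TYPE('a::real_normed_vector)"
  shows "dense (NA :: ('a, 'b::real_inner) ptensor set)"
proof (rule denseI)
  fix z :: "('a, 'b) ptensor" and \<epsilon> :: real
  assume \<epsilon>: "0 < \<epsilon>"
  interpret t: bounded_bilinear "(\<otimes>\<^sub>\<pi>) :: 'a \<Rightarrow> 'b \<Rightarrow> _" by (rule bounded_bilinear_tensor)
  obtain n :: nat and x y where xy: "norm ((\<Sum>i<n. x i \<otimes>\<^sub>\<pi> y i) - z) < \<epsilon> / 2"
    using ptensor_approx[OF half_gt_zero[OF \<epsilon>]] by blast
  obtain q h where h: "orthonormal_on {..<q} h" and span: "y ` {..<n} \<subseteq> span (h ` {..<q})"
    using orthonormal_spanning[of "y ` {..<n}"] by blast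
  define Q where "Q v = (\<Sum>j<q. (h j \<bullet> v) *\<^sub>R h j)" for v
  define s where "s = (\<Sum>i<n. norm (x i) * norm (y i))"
  have s: "0 \<le> s" unfolding s_def by (intro sum_nonneg) auto
  define \<delta> where "\<delta> = \<epsilon> / (2 * (s + 1))"
  have \<delta>: "0 < \<delta>" "s * \<delta> < \<epsilon> / 2" unfolding \<delta>_def using s \<epsilon> by (auto simp: field_simps)
  obtain P :: "'a \<Rightarrow>\<^sub>L 'a" and B m where P: "finite B" "range P = span B" "norm P \<le> 1"
    "\<And>i. P (m i) = m i" and m: "\<And>i. i < n \<Longrightarrow> norm (x i - m i) \<le> norm (x i) * \<delta>"
    by (rule metric_pi_approx[OF pi \<delta>(1), where x = x and n = n]) (rule that)
  have "(\<Sum>i<n. m i \<otimes>\<^sub>\<pi> y i) \<in> NA"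
  proof (rule attains_complemented)
    show "linear P" by (intro bounded_linear.linear blinfun.bounded_linear_right)
    show "norm (P v) \<le> norm v" for v
      using norm_blinfun[of P v] mult_right_mono[OF P(3), of "norm v"] by simp
    show "linear Q" unfolding Q_def
      by (intro linear_compose_sum ballI linearI) (auto simp: inner_add_right algebra_simps)
    show "norm (Q v) \<le> norm v" for v unfolding Q_def by (rule orthonormal_bessel[OF h]) simp
    show "range Q \<subseteq> span (h ` {..<q})" unfolding Q_def
      by (auto intro!: span_sum span_scale intro: span_base)
    show "Q (y i) = y i" if "i < n" for i
      unfolding Q_def by (rule orthonormal_expansion[OF h, symmetric]) (use span that in auto)
  qed (use P in auto)
  moreover have "dist (\<Sum>i<n. m i \<otimes>\<^sub>\<pi> y i) z < \<epsilon>"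
  proof -
    have "norm ((\<Sum>i<n. x i \<otimes>\<^sub>\<pi> y i) - (\<Sum>i<n. m i \<otimes>\<^sub>\<pi> y i)) = norm (\<Sum>i<n. (x i - m i) \<otimes>\<^sub>\<pi> y i)"
      by (simp add: t.diff_left sum_subtractf)
    also have "\<dots> \<le> (\<Sum>i<n. (norm (x i) * norm (y i)) * \<delta>)"
    proof (rule sum_norm_le)
      fix i assume "i \<in> {..<n}"
      then have "norm (x i - m i) * norm (y i) \<le> (norm (x i) * \<delta>) * norm (y i)"
        by (intro mult_right_mono m) auto
      then show "norm ((x i - m i) \<otimes>\<^sub>\<pi> y i) \<le> (norm (x i) * norm (y i)) * \<delta>"
        using norm_tensor_le[of "x i - m i" "y i"] by (simp add: mult_ac)
    qed
    also have "\<dots> = s * \<delta>" unfolding s_def by (simp add: sum_distrib_right)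
    finally have "dist (\<Sum>i<n. m i \<otimes>\<^sub>\<pi> y i) (\<Sum>i<n. x i \<otimes>\<^sub>\<pi> y i) < \<epsilon> / 2"
      using \<delta>(2) by (simp add: dist_norm norm_minus_commute)
    moreover have "dist (\<Sum>i<n. x i \<otimes>\<^sub>\<pi> y i) z < \<epsilon> / 2" using xy by (simp add: dist_norm)
    ultimately show ?thesis
      using dist_triangle[of "\<Sum>i<n. m i \<otimes>\<^sub>\<pi> y i" z "\<Sum>i<n. x i \<otimes>\<^sub>\<pi> y i"] by linarith
  qed
  ultimately show "\<exists>w\<in>NA. dist w z < \<epsilon>" by blast
qed

subsection \<open>The space of families vanishing at infinity\<close>

lift_definition c0_restrict :: "'i set \<Rightarrow> 'i c0 \<Rightarrow> 'i c0" is "\<lambda>S f i. if i \<in> S then f i else 0"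
proof -
  fix S and f :: "'i \<Rightarrow> real" assume "(f \<longlongrightarrow> 0) cofinite"
  then have "((\<lambda>i. \<bar>f i\<bar>) \<longlongrightarrow> 0) cofinite" by (rule tendsto_rabs_zero)
  then show "((\<lambda>i. if i \<in> S then f i else 0) \<longlongrightarrow> 0) cofinite"
    by (rule Lim_null_comparison[rotated]) simp
qed

lift_definition c0_unit :: "'i \<Rightarrow> 'i c0" is "\<lambda>j i. if i = j then 1 else 0"
  by (rule tendsto_eventually) (simp add: eventually_cofinite)

lemma linear_c0_apply: "linear (\<lambda>f. c0_apply f i)"
  by (rule linearI) (simp_all add: plus_c0.rep_eq scaleR_c0.rep_eq)

lemma c0_eqI: "(\<And>i. c0_apply f i = c0_apply g i) \<Longrightarrow> f = g"
  by (simp add: c0_apply_inject[symmetric] fun_eq_iff)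

lemma c0_apply_sum_unit:
  "finite S \<Longrightarrow> c0_apply (\<Sum>j\<in>S. a j *\<^sub>R c0_unit j) i = (if i \<in> S then a i else 0)"
  by (simp add: linear_sum[OF linear_c0_apply] scaleR_c0.rep_eq c0_unit.rep_eq
      if_distrib[of "\<lambda>t. _ * t"] cong: if_cong)

lemma c0_restrict_sum_unit: "finite S \<Longrightarrow> c0_restrict S f = (\<Sum>j\<in>S. c0_apply f j *\<^sub>R c0_unit j)"
  by (rule c0_eqI) (simp add: c0_apply_sum_unit c0_restrict.rep_eq)

lemma bounded_linear_c0_restrict: "bounded_linear (c0_restrict S)"
  and norm_c0_restrict_le: "norm (c0_restrict S f) \<le> norm f"
proof -
  show le: "norm (c0_restrict S f) \<le> norm f" for f
    by (rule norm_c0_le) (simp add: c0_restrict.rep_eq abs_c0_apply_le_norm)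
  show "bounded_linear (c0_restrict S)"
    by (rule bounded_linear_intro[where K = 1])
      (auto intro!: c0_eqI simp: le c0_restrict.rep_eq plus_c0.rep_eq scaleR_c0.rep_eq)
qed

lemma finite_c0_large:
  assumes "0 < e"
  shows "finite {i. \<not> \<bar>c0_apply f i\<bar> < e}"
proof -
  have "(c0_apply f \<longlongrightarrow> 0) cofinite" using c0_apply by blast
  then have "eventually (\<lambda>i. dist (c0_apply f i) 0 < e) cofinite" using assms by (rule tendstoD)
  then show ?thesis by (simp add: eventually_cofinite)
qed

text \<open>Restriction to a finite set of coordinates is a contractive projection. The set
  \<open>S\<close> collects the coordinates where some member of \<open>F\<close> has absolute value
  at least \<open>\<epsilon> / 2\<close>.\<close>

lemma metric_pi_property_c0: "metric_pi_property TYPE('i c0)"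
  unfolding metric_pi_property_def
proof (intro allI impI)
  fix \<epsilon> :: real and F :: "'i c0 set"
  assume \<epsilon>: "0 < \<epsilon>" and F: "finite F \<and> F \<subseteq> sphere 0 1"
  define S where "S = (\<Union>f\<in>F. {i. \<not> \<bar>c0_apply f i\<bar> < \<epsilon> / 2})"
  have S: "finite S" unfolding S_def
    by (rule finite_UN_I[OF conjunct1[OF F] finite_c0_large[OF half_gt_zero[OF \<epsilon>]]])
  define P where "P = Blinfun (c0_restrict S)"
  have P: "blinfun_apply P = c0_restrict S"
    unfolding P_def by (rule bounded_linear_Blinfun_apply[OF bounded_linear_c0_restrict])
  have "range P = span (c0_unit ` S)"
  proof (intro equalityI subsetI)
    show "f \<in> span (c0_unit ` S)" if "f \<in> range P" for f
      using that unfolding P c0_restrict_sum_unit[OF S]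
      by (auto intro!: span_sum span_scale intro: span_base)
    have "subspace (range P)"
      by (rule linear_subspace_image[OF bounded_linear.linear[OF blinfun.bounded_linear_right] subspace_UNIV])
    moreover have "c0_unit j \<in> range P" if "j \<in> S" for j
    proof -
      have "c0_unit j = P (c0_unit j)"
        by (rule c0_eqI) (use that in \<open>simp add: P c0_restrict.rep_eq c0_unit.rep_eq\<close>)
      then show ?thesis by (rule range_eqI)
    qed
    ultimately show "f \<in> range P" if "f \<in> span (c0_unit ` S)" for f
      using that span_minimal[of "c0_unit ` S" "range P"] by blast
  qed
  then have "finite_dimensional (range P)"
    unfolding finite_dimensional_def using S by blast
  moreover have "P o\<^sub>L P = P"
    by (intro blinfun_eqI c0_eqI) (simp add: P c0_restrict.rep_eq)
  moreover have "norm P \<le> 1" by (rule norm_blinfun_bound) (simp_all add: P norm_c0_restrict_le)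
  moreover have "norm (f - P f) < \<epsilon>" if "f \<in> F" for f
  proof -
    have "norm (f - P f) \<le> \<epsilon> / 2"
    proof (rule norm_c0_le)
      fix i
      have "\<bar>c0_apply f i\<bar> < \<epsilon> / 2" if "i \<notin> S" using that \<open>f \<in> F\<close> unfolding S_def by blast
      then show "\<bar>c0_apply (f - P f) i\<bar> \<le> \<epsilon> / 2"
        using \<epsilon> by (cases "i \<in> S") (auto simp: P minus_c0.rep_eq c0_restrict.rep_eq)
    qed
    then show ?thesis using \<epsilon> by simp
  qed
  ultimately show "\<exists>M. finite_dimensional M \<and> one_complemented M \<and> (\<forall>f\<in>F. \<exists>f'\<in>M. norm (f - f') < \<epsilon>)"
    unfolding one_complemented_def by blast
qed

text \<open>The supremum norm on the first \<open>n\<close> coordinates. The recursion starts at 0,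
  so an empty set of coordinates is harmless, and continuity follows by induction.\<close>

primrec max_abs :: "nat \<Rightarrow> (nat \<Rightarrow> real) \<Rightarrow> real" where
  "max_abs 0 a = 0"
| "max_abs (Suc n) a = max (max_abs n a) \<bar>a n\<bar>"

lemma max_abs_ge: "k < n \<Longrightarrow> \<bar>a k\<bar> \<le> max_abs n a"
  by (induction n) (auto simp: less_Suc_eq le_max_iff_disj)

lemma max_abs_le: "0 \<le> c \<Longrightarrow> (\<And>k. k < n \<Longrightarrow> \<bar>a k\<bar> \<le> c) \<Longrightarrow> max_abs n a \<le> c"
  by (induction n) auto

lemma continuous_map_max_abs: "continuous_map (Euclidean_space m) euclideanreal (max_abs n)"
proof (induction n)
  case (Suc n)
  have "continuous_map (Euclidean_space m) euclideanreal (\<lambda>a. a n)"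
    unfolding Euclidean_space_def
    by (intro continuous_map_from_subtopology continuous_map_product_projection) simp
  then show ?case using Suc by (simp add: continuous_map_real_max continuous_map_real_abs)
qed simp

text \<open>Let \<open>r\<close> be the norm of \<open>x\<close>. Within distance
  \<open>r / 4\<close> of \<open>x\<close>, coordinates outside the finite set \<open>S\<close> stay
  at most \<open>3 * r / 4\<close> in absolute value while the norm exceeds this, so the coordinates
  in \<open>S\<close> alone determine the norm.\<close>

lemma locally_finitely_many_coordinates_c0: "locally_finitely_many_coordinates TYPE('i c0)"
  unfolding locally_finitely_many_coordinates_def
proof (intro allI impI)
  fix x :: "'i c0" assume "x \<noteq> 0"
  define r where "r = norm x"
  have r: "0 < r" unfolding r_def using \<open>x \<noteq> 0\<close> by simp
  define S where "S = {i. \<not> \<bar>c0_apply x i\<bar> < r / 2}"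
  have S: "finite S" unfolding S_def using r by (intro finite_c0_large) simp
  define N where "N = card S"
  obtain g where g: "bij_betw g {..<N} S"
    using ex_bij_betw_nat_finite[OF S] unfolding atLeast0LessThan N_def by blast
  define f where "f k = Blinfun (\<lambda>y. c0_apply y (g k))" for k
  have f: "f k y = c0_apply y (g k)" for k y
  proof -
    have "bounded_linear (\<lambda>y :: 'i c0. c0_apply y (g k))"
      by (rule bounded_linear_intro[where K = 1])
        (simp_all add: plus_c0.rep_eq scaleR_c0.rep_eq abs_c0_apply_le_norm)
    then show ?thesis unfolding f_def by (simp add: bounded_linear_Blinfun_apply)
  qed
  have "norm y = max_abs N (\<lambda>k. if k < N then f k y else 0)" (is "_ = ?m") if y: "norm (y - x) < r / 4" for y
  proof (rule antisym)
    show "?m \<le> norm y"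
      by (rule max_abs_le) (simp_all add: f abs_c0_apply_le_norm)
    have "norm y \<le> max ?m (3 * r / 4)"
    proof (rule norm_c0_le)
      fix i
      show "\<bar>c0_apply y i\<bar> \<le> max ?m (3 * r / 4)"
      proof (cases "i \<in> S")
        case True
        then obtain k where "k < N" "i = g k" using g unfolding bij_betw_def by auto
        then show ?thesis using max_abs_ge[of k N "\<lambda>k. if k < N then f k y else 0"] by (simp add: f)
      next
        case False
        then have "\<bar>c0_apply x i\<bar> < r / 2" unfolding S_def by simp
        moreover have "\<bar>c0_apply (y - x) i\<bar> < r / 4"
          using abs_c0_apply_le_norm[of "y - x" i] y by simp
        ultimately have "\<bar>c0_apply y i\<bar> \<le> 3 * r / 4" unfolding minus_c0.rep_eq by linarith
        then show ?thesis by simp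
      qed
    qed
    moreover have "3 * r / 4 < norm y"
      using norm_triangle_ineq2[of x "x - y"] y unfolding r_def by (simp add: norm_minus_commute)
    ultimately show "norm y \<le> ?m" by simp
  qed
  then show "\<exists>\<epsilon>>0. \<exists>(N::nat) (f :: nat \<Rightarrow> 'i c0 \<Rightarrow>\<^sub>L real) \<phi>.
      continuous_map (Euclidean_space N) euclideanreal \<phi> \<and>
      (\<forall>y. norm (y - x) < \<epsilon> \<longrightarrow> norm y = \<phi> (\<lambda>i. if i < N then f i y else 0))"
    using r
    by (intro exI[of _ "r / 4"] conjI exI[of _ N] exI[of _ f] exI[of _ "max_abs N"] allI impI
        continuous_map_max_abs) simp_all
qed

lemma infinite_dimensional_c0:
  assumes "infinite (UNIV :: 'i set)"
  shows "infinite_dimensional TYPE('i c0)"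
  unfolding infinite_dimensional_def finite_dimensional_def
proof
  assume "\<exists>B. finite B \<and> (UNIV :: 'i c0 set) = span B"
  then obtain B :: "'i c0 set" where B: "finite B" "UNIV = span B" by blast
  obtain S :: "'i set" where S: "finite S" "card S = Suc (card B)"
    using infinite_arbitrarily_large[OF assms] by blast
  have inj: "inj_on c0_unit S"
  proof (rule inj_onI)
    fix i j :: 'i assume "c0_unit i = c0_unit j"
    then have "c0_apply (c0_unit i) i = c0_apply (c0_unit j) i" by simp
    then show "i = j" by (simp add: c0_unit.rep_eq split: if_splits)
  qed
  have "independent (c0_unit ` S)"
  proof
    assume "dependent (c0_unit ` S)"
    then obtain u j where j: "j \<in> S" "u (c0_unit j) \<noteq> 0" and "(\<Sum>v\<in>c0_unit ` S. u v *\<^sub>R v) = 0"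
      unfolding dependent_finite[OF finite_imageI[OF S(1)]] by auto
    then have "(\<Sum>i\<in>S. u (c0_unit i) *\<^sub>R c0_unit i) = 0" by (simp add: sum.reindex[OF inj])
    then have "c0_apply (\<Sum>i\<in>S. u (c0_unit i) *\<^sub>R c0_unit i) j = 0" by (simp add: zero_c0.rep_eq)
    then show False using j by (simp add: c0_apply_sum_unit[OF S(1)])
  qed
  moreover have "c0_unit ` S \<subseteq> span B" using B(2) by blast
  ultimately have "card (c0_unit ` S) \<le> card B" using independent_span_bound[OF B(1)] by blast
  then show False using S(2) card_image[OF inj] by simp
qed

text \<open>If both factors are finite dimensional, compactness makes every tensor attain its norm;
  density of the complement is therefore claimed for infinite-dimensional factors, which for
  \<open>c0\<close> means an infinite index type.\<close>

theorem theorem3p3: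
  shows
    "(metric_pi_property TYPE('x::banach) \<and> locally_finitely_many_coordinates TYPE('x) \<longrightarrow>
        dense (NA :: ('x, 'y::{real_inner, banach}) ptensor set) \<and>
        (infinite_dimensional TYPE('x) \<and> infinite_dimensional TYPE('y) \<longrightarrow>
          dense (- NA :: ('x, 'y) ptensor set))) \<and>
     metric_pi_property TYPE('i c0) \<and> locally_finitely_many_coordinates TYPE('i c0) \<and>
     dense (NA :: ('i c0, 'y) ptensor set) \<and>
     (infinite (UNIV :: 'i set) \<and> infinite_dimensional TYPE('y) \<longrightarrow>
        dense (- NA :: ('i c0, 'y) ptensor set))"
  by (intro conjI impI; (elim conjE)?;
      rule dense_NA dense_not_NA metric_pi_property_c0 locally_finitely_many_coordinates_c0;
      (rule metric_pi_property_c0 locally_finitely_many_coordinates_c0 infinite_dimensional_c0)?;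
      assumption?)

end
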